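(* Let $X\subset\mathbb{R}^N$ and $Y\subset\mathbb{R}^P$ be locally finite geometric simplicial complexes and let $f\colon X\to Y$ be a surjective simplicial map with finite fibres. For each $k\ge 1$ let $Z^k$ be $W^k(f)$ (for all $k$) or $D^k(f)$ (for all $k$), with the triangulation associated to $f$. Then: (1) for every $k\ge 2$ and $1\le i\le k$, the projection $\varepsilon^{i,k}\colon Z^k\to Z^{k-1}$ forgetting the $i$-th component is a simplicial map; (2) for every $n\ge 0$, the two sequences of groups of simplicial chains $$\cdots\to C_n(W^k(f))\xrightarrow{\rho^k_n}C_n(W^{k-1}(f))\to\cdots\xrightarrow{\rho^3_n}C_n(W^2(f))\xrightarrow{\rho^2_n}C_n(X)\xrightarrow{f_{\#,n}}C_n(Y)\to 0,$$ $$\cdots\to C_n^{\mathrm{Alt}}(D^k(f))\xrightarrow{\varepsilon^k_{\#,n}}C_n^{\mathrm{Alt}}(D^{k-1}(f))\to\cdots\xrightarrow{\varepsilon^3_{\#,n}}C_n^{\mathrm{Alt}}(D^2(f))\xrightarrow{\varepsilon^2_{\#,n}}C_n(X)\xrightarrow{f_{\#,n}}C_n(Y)\to 0$$ are exact chain complexes (i.e. acyclic resolutions of $C_n(Y)$).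
   Context: A simplicial map sends the vertices of each simplex to vertices of a simplex and is affine on each simplex. For $k\ge 1$, $W^k(f)=\{(x_1,\dots,x_k)\in X^k : f(x_1)=\dots=f(x_k)\}$, and $D^k(f)$ is the closure in $X^k$ of $\{(x_1,\dots,x_k)\in X^k : f(x_1)=\dots=f(x_k),\ x_i\ne x_j \text{ for } i\neq j\}$; thus $W^1(f)=D^1(f)=X$ and $D^k(f)\subset W^k(f)$. The symmetric group $S_k$ acts on both by permuting components. $\pi_\ell$ denotes the $\ell$-th projection to $X$. Write $\varepsilon^k=\varepsilon^{k,k}$ for the map forgetting the last component. Associated triangulation: for a point $x$ of a simplicial complex let $\Gamma_x$ be the unique geometric simplex containing $x$ in its interior. Let $\mathbf{x}\in W^k(f)$, $y=f(\pi_1(\mathbf{x}))$ and let $w_0,\dots,w_n$ be the vertices of $\Gamma_y$. For each $\ell$, $f$ maps $\Gamma_{\pi_\ell(\mathbf{x})}$ isomorphically onto $\Gamma_y$; let $v^{(\ell)}_j$ be the vertex of $\Gamma_{\pi_\ell(\mathbf{x})}$ with $f(v^{(\ell)}_j)=w_j$. Let $\Gamma^{(k)}_{\mathbf{x}}\subset(\mathbb{R}^N)^k$ be the geometric $n$-simplex with vertices $(v^{(1)}_j,\dots,v^{(k)}_j)$, $j=0,\dots,n$. The simplices of $W^k(f)$ (resp. $D^k(f)$) are the $\Gamma^{(k)}_{\mathbf{x}}$ with $\mathbf{x}\in W^k(f)$ (resp. $\mathbf{x}\in D^k(f)$). Chains: an ordered $n$-simplex is a geometric $n$-simplex together with an ordering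 of its $n+1$ vertices; $C_n(\cdot)$ is the free abelian group on the ordered $n$-simplices. The maps $f$ and $\varepsilon^{i,k}$, and the action of $\sigma\in S_k$, induce homomorphisms $f_{\#,n}$, $\varepsilon^{i,k}_{\#,n}$, $\sigma_\#$ on $C_n$ by applying the map to the vertices. $C_n^{\mathrm{Alt}}(D^k(f))=\{c\in C_n(D^k(f)) : \sigma_\#(c)=\mathrm{sign}(\sigma)c\ \text{for all }\sigma\in S_k\}$. Finally $\rho^k_n=\sum_{i=1}^k(-1)^{i-1}\varepsilon^{i,k}_{\#,n}$. *)

theory Defs
  imports
    "HOL-Analysis.Analysis"
    "HOL-Algebra.Free_Abelian_Groups"
    "HOL-Algebra.Elementary_Groups"
    "HOL-Combinatorics.Permutations"
    "HOL-Library.Function_Algebras"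
begin

text \<open>
  A \<open>k\<close>-tuple of elements of a real vector space \<open>'a\<close> is a function \<open>nat \<Rightarrow> 'a\<close> that vanishes
  outside \<open>{1..k}\<close>, so that \<open>(\<real>\<^sup>N)\<^sup>k\<close> is a linear subspace of \<open>nat \<Rightarrow> 'a\<close>. With the pointwise
  vector space structure below, convex hulls and extreme points of sets of tuples are
  the library notions. The topology on \<open>nat \<Rightarrow> 'a\<close> is the product topology, and it induces the
  usual topology on \<open>(\<real>\<^sup>N)\<^sup>k\<close>.
\<close>

instantiation "fun" :: (type, real_vector) real_vector
begin

definition scaleR_fun_def: "r *\<^sub>R f = (\<lambda>x. r *\<^sub>R f x)"

instance
  by standard (simp_all add: scaleR_fun_def fun_eq_iff scaleR_add_right scaleR_add_left)

end

definition tuples :: "nat \<Rightarrow> 'a::zero set \<Rightarrow> (nat \<Rightarrow> 'a) set" where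
  "tuples k A = {x. (\<forall>i\<in>{1..k}. x i \<in> A) \<and> (\<forall>i. i \<notin> {1..k} \<longrightarrow> x i = 0)}"


section \<open>Geometric simplicial complexes and simplicial maps\<close>

text \<open>
  As \<^const>\<open>simplicial_complex\<close>, with finiteness replaced by local finiteness in the
  underlying space \<open>\<Union>K\<close>. As there, the empty face of a simplex belongs to the complex.
\<close>

definition locally_finite_complex :: "'a::euclidean_space set set \<Rightarrow> bool" where
  "locally_finite_complex K \<longleftrightarrow>
     (\<forall>S\<in>K. \<exists>n. n simplex S) \<and>
     (\<forall>F S. S \<in> K \<and> F face_of S \<longrightarrow> F \<in> K) \<and>
     (\<forall>S S'. S \<in> K \<and> S' \<in> K \<longrightarrow> (S \<inter> S') face_of S) \<and>
     locally_finite_in (top_of_set (\<Union>K)) K"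

definition vertices :: "'a::real_vector set \<Rightarrow> 'a set" where
  "vertices S = {v. v extreme_point_of S}"

definition affine_map_on :: "'a::real_vector set \<Rightarrow> ('a \<Rightarrow> 'b::real_vector) \<Rightarrow> bool" where
  "affine_map_on S g \<longleftrightarrow>
     (\<forall>x\<in>S. \<forall>y\<in>S. \<forall>t\<in>{0..1}. g ((1 - t) *\<^sub>R x + t *\<^sub>R y) = (1 - t) *\<^sub>R g x + t *\<^sub>R g y)"

definition simplicial_map ::
    "'a::real_vector set set \<Rightarrow> 'b::real_vector set set \<Rightarrow> ('a \<Rightarrow> 'b) \<Rightarrow> bool" where
  "simplicial_map K L g \<longleftrightarrow>
     (\<forall>S\<in>K. (\<exists>T\<in>L. g ` vertices S = vertices T) \<and> affine_map_on S g)"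


section \<open>Multiple point spaces and their associated triangulation\<close>

definition W_space :: "('a::euclidean_space \<Rightarrow> 'b) \<Rightarrow> 'a set \<Rightarrow> nat \<Rightarrow> (nat \<Rightarrow> 'a) set" where
  "W_space f X k = {x \<in> tuples k X. \<forall>i\<in>{1..k}. \<forall>j\<in>{1..k}. f (x i) = f (x j)}"

definition D_space :: "('a::euclidean_space \<Rightarrow> 'b) \<Rightarrow> 'a set \<Rightarrow> nat \<Rightarrow> (nat \<Rightarrow> 'a) set" where
  "D_space f X k = tuples k X \<inter> closure {x \<in> W_space f X k. inj_on x {1..k}}"

lemma W_space_1: "W_space f X 1 = tuples 1 X"
  by (auto simp: W_space_def simp del: One_nat_def)

lemma D_space_1: "D_space f X 1 = tuples 1 X"
proof -
  have "{x \<in> W_space f X 1. inj_on x {1..1}} = tuples 1 X"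
    by (auto simp: W_space_1 simp del: One_nat_def)
  then show ?thesis
    using closure_subset[of "tuples 1 X"] by (auto simp: D_space_def)
qed

definition carrier_simplex :: "'a::euclidean_space set set \<Rightarrow> 'a \<Rightarrow> 'a set" where
  "carrier_simplex K x = (THE S. S \<in> K \<and> x \<in> rel_interior S)"

text \<open>
  The simplex \<open>\<Gamma>\<^sup>k\<^sub>x\<close>: its vertices are the tuples \<open>(v\<^sub>1, \<dots>, v\<^sub>k)\<close>, one for each vertex \<open>w\<close> of the
  simplex of \<open>y = f x\<^sub>1\<close>, such that \<open>v\<^sub>l\<close> is the vertex of the simplex of \<open>x\<^sub>l\<close> with \<open>f v\<^sub>l = w\<close>.
\<close>

definition assoc_simplex ::
    "'a::euclidean_space set set \<Rightarrow> 'b::euclidean_space set set \<Rightarrow> ('a \<Rightarrow> 'b) \<Rightarrow> nat \<Rightarrow> (nat \<Rightarrow> 'a)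
       \<Rightarrow> (nat \<Rightarrow> 'a) set" where
  "assoc_simplex K L f k x =
     convex hull {v \<in> tuples k (\<Union>K). \<exists>w\<in>vertices (carrier_simplex L (f (x 1))).
        \<forall>l\<in>{1..k}. v l \<in> vertices (carrier_simplex K (x l)) \<and> f (v l) = w}"

definition W_complex ::
    "'a::euclidean_space set set \<Rightarrow> 'b::euclidean_space set set \<Rightarrow> ('a \<Rightarrow> 'b) \<Rightarrow> nat
       \<Rightarrow> (nat \<Rightarrow> 'a) set set" where
  "W_complex K L f k = assoc_simplex K L f k ` W_space f (\<Union>K) k"

definition D_complex ::
    "'a::euclidean_space set set \<Rightarrow> 'b::euclidean_space set set \<Rightarrow> ('a \<Rightarrow> 'b) \<Rightarrow> nat
       \<Rightarrow> (nat \<Rightarrow> 'a) set set" where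
  "D_complex K L f k = assoc_simplex K L f k ` D_space f (\<Union>K) k"

text \<open>
  \<open>forget i\<close> is \<open>\<epsilon>\<^sup>i\<^sup>,\<^sup>k\<close>. It need not depend on \<open>k\<close>: a \<open>k\<close>-tuple vanishes at \<open>k + 1\<close>, so for
  \<open>1 \<le> i \<le> k\<close> its image is a \<open>(k - 1)\<close>-tuple.
\<close>

definition forget :: "nat \<Rightarrow> (nat \<Rightarrow> 'a) \<Rightarrow> nat \<Rightarrow> 'a" where
  "forget i x = (\<lambda>l. if l < i then x l else x (Suc l))"

text \<open>
  The identification of the space of \<open>1\<close>-tuples of points of \<open>X\<close> with \<open>X\<close>.
\<close>

definition untuple :: "(nat \<Rightarrow> 'a) \<Rightarrow> 'a" where
  "untuple x = x 1"

definition permute :: "(nat \<Rightarrow> nat) \<Rightarrow> (nat \<Rightarrow> 'a) \<Rightarrow> nat \<Rightarrow> 'a" where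
  "permute \<sigma> x = x \<circ> inv_into UNIV \<sigma>"


section \<open>Chains\<close>

text \<open>
  An ordered simplex is represented by the list of its vertices, which determines the
  simplex.
\<close>

definition ordered_simplices :: "nat \<Rightarrow> 'a::real_vector set set \<Rightarrow> 'a list set" where
  "ordered_simplices n K =
     {vs. length vs = n + 1 \<and> distinct vs \<and> (\<exists>S\<in>K. set vs = vertices S)}"

definition simplicial_chains :: "nat \<Rightarrow> 'a::real_vector set set \<Rightarrow> ('a list \<Rightarrow>\<^sub>0 int) monoid" where
  "simplicial_chains n K = free_Abelian_group (ordered_simplices n K)"

definition push :: "('a \<Rightarrow> 'b) \<Rightarrow> ('a list \<Rightarrow>\<^sub>0 int) \<Rightarrow> ('b list \<Rightarrow>\<^sub>0 int)" where
  "push g = frag_extend (\<lambda>vs. frag_of (map g vs))"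

definition alternating_chains ::
    "nat \<Rightarrow> nat \<Rightarrow> (nat \<Rightarrow> 'a::real_vector) set set \<Rightarrow> ((nat \<Rightarrow> 'a) list \<Rightarrow>\<^sub>0 int) monoid" where
  "alternating_chains n k T = (simplicial_chains n T)\<lparr>carrier :=
     {c \<in> carrier (simplicial_chains n T).
        \<forall>\<sigma>. \<sigma> permutes {1..k} \<longrightarrow> push (permute \<sigma>) c = frag_cmul (sign \<sigma>) c}\<rparr>"

definition rho :: "nat \<Rightarrow> ((nat \<Rightarrow> 'a) list \<Rightarrow>\<^sub>0 int) \<Rightarrow> ((nat \<Rightarrow> 'a) list \<Rightarrow>\<^sub>0 int)" where
  "rho k c = (\<Sum>i=1..k. frag_cmul ((-1) ^ (i - 1)) (push (forget i) c))"

text \<open>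
  Exactness of \<open>G \<rightarrow> H \<rightarrow> M\<close> at \<open>H\<close>. The library's \<^const>\<open>kernel\<close> is used directly because its
  inductive predicate for exact sequences needs all groups to have the same element type and
  covers finite sequences only.
\<close>

definition exact_at ::
    "'a monoid \<Rightarrow> ('a \<Rightarrow> 'b) \<Rightarrow> 'b monoid \<Rightarrow> ('b \<Rightarrow> 'c) \<Rightarrow> 'c monoid \<Rightarrow> bool" where
  "exact_at G g H h M \<longleftrightarrow>
     group_hom G H g \<and> group_hom H M h \<and> g ` carrier G = kernel H M h"

end

theory Submission
  imports Defs
begin

text \<open>
  Finite fibres force \<open>f\<close> to be injective on every simplex, so \<open>f\<close> maps the carrier of \<open>x\<close>
  isomorphically onto the carrier of \<open>f x\<close>. Evaluating at barycenters, one sees that an ordered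
  \<open>n\<close>-simplex of \<open>W\<^sup>k\<close> is the same as a \<open>k\<close>-tuple (the columns) of ordered \<open>n\<close>-simplices of \<open>X\<close> with a
  common image in \<open>Y\<close>; those with distinct columns lie in \<open>D\<^sup>k\<close>. So both sequences split over the
  ordered simplices of \<open>Y\<close>, where the first is the augmented chain complex of a full simplex and the
  second a Koszul complex. Both are contracted by choosing a lift of every ordered simplex of \<open>Y\<close> and
  appending it as an additional column, followed by antisymmetrization in the second case.
  Alternating chains on \<open>D\<^sup>k\<close> and on \<open>W\<^sup>k\<close> coincide since they vanish on simplices with two equal columns.
\<close>

section \<open>Simplicial maps with finite fibres\<close>

text \<open>The triangulation is indexed by points, so a matrix of vertices belongs to it only once
  a point of W^k with the right carriers is produced. Barycenters serve because they lie in relative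
  interiors, depend only on the vertex set, and are preserved by f, whose injectivity on vertices
  keeps the uniform weights; hence columns with equal images have barycenters with equal images. The
  difficulty with D^k is the closure: a matrix with repeated columns may or may not come from a
  limit point. This is never decided. It is enough that D^k lies in W^k, which rests on continuity
  of f and thereby on local finiteness, and that matrices with distinct columns are reached without
  a limit. The lift depends only on the common image of the columns, so appending it commutes with
  permuting the old columns and with forgetting one of them, as long as one remains from which the
  image can be read. The end of the sequences at X, where 1-tuples become points, is therefore
  treated separately. Antisymmetrization sums over k + 1 coset representatives only, which avoids
  dividing by factorials over the integers.\<close>

lemma affine_map_on_sum:
  fixes x :: "'i \<Rightarrow> 'a::real_vector" and g :: "'a \<Rightarrow> 'b::real_vector"
  assumes g: "affine_map_on S g" and S: "convex S" and I: "finite I"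
    and x: "\<And>i. i \<in> I \<Longrightarrow> x i \<in> S" and u: "\<And>i. i \<in> I \<Longrightarrow> 0 \<le> u i" "sum u I = 1"
  shows "g (\<Sum>i\<in>I. u i *\<^sub>R x i) = (\<Sum>i\<in>I. u i *\<^sub>R g (x i))"
proof -
  \<comment> \<open>As \<open>S\<close> is convex, the two-point condition makes the graph over
    \<open>S\<close> convex, so convex combinations of finitely many graph points stay on
    it.\<close>
  let ?G = "(\<lambda>x. (x, g x)) ` S"
  have "convex ?G"
    unfolding convex_alt
  proof (intro ballI allI impI)
    fix p q :: "'a \<times> 'b" and t :: real
    assume pq: "p \<in> ?G" "q \<in> ?G" and t: "0 \<le> t \<and> t \<le> 1"
    then obtain y z where y: "y \<in> S" "p = (y, g y)" and z: "z \<in> S" "q = (z, g z)"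
      by blast
    let ?m = "(1 - t) *\<^sub>R y + t *\<^sub>R z"
    have "?m \<in> S"
      using S y z t unfolding convex_alt by blast
    moreover have "g ?m = (1 - t) *\<^sub>R g y + t *\<^sub>R g z"
      using g y z t unfolding affine_map_on_def by auto
    ultimately show "(1 - t) *\<^sub>R p + t *\<^sub>R q \<in> ?G"
      using y z by (simp add: image_iff)
  qed
  then have "(\<Sum>i\<in>I. u i *\<^sub>R (x i, g (x i))) \<in> ?G"
    by (rule convex_sum[OF I]) (use u x in auto)
  then show ?thesis
    by (auto simp: image_iff scaleR_Pair fst_sum snd_sum prod_eq_iff)
qed

section \<open>Simplices, carriers and barycenters\<close>

lemma simplex_vertices:
  assumes "n simplex S"
  shows "\<not> affine_dependent (vertices S)" "convex hull (vertices S) = S" "finite (vertices S)"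
proof -
  obtain C where C: "\<not> affine_dependent C" "S = convex hull C"
    using assms unfolding simplex_def by blast
  then have "vertices S = C"
    by (simp add: vertices_def extreme_point_of_convex_hull_affine_independent)
  with C show "\<not> affine_dependent (vertices S)" "convex hull (vertices S) = S" "finite (vertices S)"
    by (simp_all add: aff_independent_finite)
qed

text \<open>Defined on vertex sets rather than simplices, so that it applies directly to the entries
  of a column.\<close>

definition barycenter :: "'a::real_vector set \<Rightarrow> 'a" where
  "barycenter V = (\<Sum>v\<in>V. (1 / card V) *\<^sub>R v)"

lemma complex_vertices:
  assumes "locally_finite_complex K" "S \<in> K"
  shows "\<not> affine_dependent (vertices S)" "convex hull (vertices S) = S" "finite (vertices S)"
    "convex S" "compact S"
proof -
  obtain n where n: "n simplex S"
    using assms unfolding locally_finite_complex_def by blast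
  show *: "\<not> affine_dependent (vertices S)" "convex hull (vertices S) = S" "finite (vertices S)"
    using simplex_vertices[OF n] by auto
  show "convex S" "compact S"
    using * convex_convex_hull[of "vertices S"] finite_imp_compact_convex_hull[of "vertices S"] by auto
qed

lemma complex_rel_interior:
  assumes "locally_finite_complex K" "S \<in> K"
  shows "x \<in> rel_interior S \<longleftrightarrow>
    (\<exists>u. (\<forall>v\<in>vertices S. 0 < u v) \<and> sum u (vertices S) = 1 \<and> (\<Sum>v\<in>vertices S. u v *\<^sub>R v) = x)"
  using rel_interior_convex_hull_explicit[OF complex_vertices(1)[OF assms]]
    complex_vertices(2)[OF assms] by auto

text \<open>A face of a simplex that meets its relative interior is the whole simplex. Applied to
  the intersection of two simplices with a common interior point, this gives both
  inclusions.\<close>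

lemma carrier_simplex_eq:
  assumes K: "locally_finite_complex K" and S: "S \<in> K" and x: "x \<in> rel_interior S"
  shows "carrier_simplex K x = S"
  unfolding carrier_simplex_def
proof (rule the_equality)
  fix T assume T: "T \<in> K \<and> x \<in> rel_interior T"
  have face: "(A \<inter> B) face_of A" if "A \<in> K" "B \<in> K" for A B
    using K that unfolding locally_finite_complex_def by blast
  have "A \<subseteq> B" if "A \<in> K" "B \<in> K" "x \<in> rel_interior A" "x \<in> rel_interior B" for A B
    using subset_of_face_of[OF face[OF that(1,2)] order_refl] that(3,4)
      rel_interior_subset[of A] rel_interior_subset[of B] by blast
  with S x T show "T = S" by blast
qed (use assms in auto)

lemma carrier_simplex:
  assumes K: "locally_finite_complex K" and x: "x \<in> \<Union>K"
  shows "carrier_simplex K x \<in> K" "x \<in> rel_interior (carrier_simplex K x)"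
proof -
  obtain S where S: "S \<in> K" "x \<in> S" using x by blast
  let ?V = "vertices S"
  note V = complex_vertices[OF K S(1)]
  have "x \<in> convex hull ?V" using S V by simp
  then obtain u where u: "\<And>v. v \<in> ?V \<Longrightarrow> 0 \<le> u v" "sum u ?V = 1" "(\<Sum>v\<in>?V. u v *\<^sub>R v) = x"
    unfolding convex_hull_finite[OF V(3)] by blast
  \<comment> \<open>Dropping the vertices with zero barycentric coordinate leaves the face in which
    all coordinates of \<open>x\<close> are positive.\<close>
  define C where "C = {v \<in> ?V. u v \<noteq> 0}"
  have C: "C \<subseteq> ?V" by (auto simp: C_def)
  then have indep: "\<not> affine_dependent C"
    using V(1) affine_independent_subset by blast
  have "convex hull C face_of S"
    using face_of_convex_hull_affine_independent[OF V(1)] C V(2) by auto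
  then have CK: "convex hull C \<in> K"
    using K S unfolding locally_finite_complex_def by blast
  have "sum u C = 1" "(\<Sum>v\<in>C. u v *\<^sub>R v) = x"
    using u(2,3) sum.mono_neutral_right[OF V(3) C, of u]
      sum.mono_neutral_right[OF V(3) C, of "\<lambda>v. u v *\<^sub>R v"]
    by (auto simp: C_def)
  moreover have "\<forall>v\<in>C. 0 < u v"
    using u(1) by (force simp: C_def less_le)
  ultimately have "x \<in> rel_interior (convex hull C)"
    unfolding rel_interior_convex_hull_explicit[OF indep] by blast
  with carrier_simplex_eq[OF K CK] CK
  show "carrier_simplex K x \<in> K" "x \<in> rel_interior (carrier_simplex K x)"
    by auto
qed

text \<open>The empty simplex has to be excluded: its weights cannot sum to one.\<close>

lemma barycenter_rel_interior:
  assumes K: "locally_finite_complex K" and S: "S \<in> K" "vertices S \<noteq> {}"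
  shows "barycenter (vertices S) \<in> rel_interior S"
  unfolding complex_rel_interior[OF K S(1)] barycenter_def
  using S complex_vertices(3)[OF K S(1)]
  by (intro exI[of _ "\<lambda>v. 1 / card (vertices S)"]) (auto simp: card_gt_0_iff)

section \<open>Injectivity and continuity of a simplicial map with finite fibres\<close>

locale finite_to_one_simplicial_map =
  fixes K :: "'a::euclidean_space set set" and L :: "'b::euclidean_space set set" and f :: "'a \<Rightarrow> 'b"
  assumes K: "locally_finite_complex K" and L: "locally_finite_complex L"
    and simplicial: "simplicial_map K L f" and surj: "f ` (\<Union>K) = \<Union>L"
    and fibres: "\<forall>y\<in>\<Union>L. finite {x \<in> \<Union>K. f x = y}"
begin

lemma image_vertices:
  assumes "S \<in> K"
  obtains T where "T \<in> L" "f ` vertices S = vertices T"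
  using assms simplicial unfolding simplicial_map_def by auto

lemma affine_on_simplex: "S \<in> K \<Longrightarrow> affine_map_on S f"
  using simplicial unfolding simplicial_map_def by blast

lemma vertices_subset: "S \<in> K \<Longrightarrow> vertices S \<subseteq> S"
  by (metis K complex_vertices(2) hull_subset)

text \<open>Two vertices with the same image would make \<open>f\<close> constant on the segment
  between them, an infinite set inside one fibre.\<close>

lemma inj_on_simplex_vertices:
  assumes S: "S \<in> K"
  shows "inj_on f (vertices S)"
proof (rule inj_onI, rule ccontr)
  fix v w assume vw: "v \<in> vertices S" "w \<in> vertices S" "f v = f w" "v \<noteq> w"
  then have vwS: "v \<in> S" "w \<in> S" using vertices_subset[OF S] by auto
  have *: "f x = f v" "x \<in> S" if "x \<in> closed_segment v w" for x
  proof -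
    obtain t where t: "0 \<le> t" "t \<le> 1" "x = (1 - t) *\<^sub>R v + t *\<^sub>R w"
      using \<open>x \<in> closed_segment v w\<close> by (auto simp: in_segment)
    have "t \<in> {0..1}" using t by simp
    then have "f x = (1 - t) *\<^sub>R f v + t *\<^sub>R f w"
      using affine_on_simplex[OF S] vwS t(3) unfolding affine_map_on_def by blast
    then show "f x = f v"
      using vw(3) by (simp add: scaleR_left_diff_distrib)
    show "x \<in> S"
      using complex_vertices(4)[OF K S] vwS that
      unfolding convex_contains_segment by blast
  qed
  have "closed_segment v w \<subseteq> {x \<in> \<Union>K. f x = f v}"
    using S * by blast
  moreover have "f v \<in> \<Union>L"
    using surj vwS S by blast
  ultimately have "finite (closed_segment v w)"
    using fibres finite_subset by blast
  then show False
    using vw(4) by (simp add: finite_closed_segment)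
qed

lemma simplex_map_sum:
  assumes S: "S \<in> K" and u: "\<And>v. v \<in> vertices S \<Longrightarrow> 0 \<le> u v" "sum u (vertices S) = 1"
  shows "f (\<Sum>v\<in>vertices S. u v *\<^sub>R v) = (\<Sum>v\<in>vertices S. u v *\<^sub>R f v)"
  using affine_map_on_sum[OF affine_on_simplex[OF S] complex_vertices(4,3)[OF K S], of "\<lambda>v. v" u]
    vertices_subset[OF S] u by auto

text \<open>Since \<open>f\<close> is injective on vertices, the barycentric coordinates of
  \<open>x\<close> become those of \<open>f x\<close> after renaming the vertices, so positivity
  survives.\<close>

lemma rel_interior_image:
  assumes S: "S \<in> K" and T: "T \<in> L" "f ` vertices S = vertices T" and x: "x \<in> rel_interior S"
  shows "f x \<in> rel_interior T"
proof -
  obtain u where u: "\<And>v. v \<in> vertices S \<Longrightarrow> 0 < u v" "sum u (vertices S) = 1"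
      "(\<Sum>v\<in>vertices S. u v *\<^sub>R v) = x"
    using x unfolding complex_rel_interior[OF K S] by blast
  note inj = inj_on_simplex_vertices[OF S]
  let ?g = "inv_into (vertices S) f"
  have "f x = (\<Sum>v\<in>vertices S. u v *\<^sub>R f v)"
    using simplex_map_sum[OF S, of u] u by (auto simp: less_imp_le)
  also have "\<dots> = (\<Sum>w\<in>vertices T. u (?g w) *\<^sub>R w)"
    unfolding T(2)[symmetric] by (simp add: sum.reindex[OF inj] inv_into_f_f[OF inj])
  finally have "(\<Sum>w\<in>vertices T. u (?g w) *\<^sub>R w) = f x" ..
  moreover have "(\<Sum>w\<in>vertices T. u (?g w)) = 1"
    unfolding T(2)[symmetric] using u(2) by (simp add: sum.reindex[OF inj] inv_into_f_f[OF inj])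
  moreover have "\<forall>w\<in>vertices T. 0 < u (?g w)"
    unfolding T(2)[symmetric] using u(1) by (simp add: inv_into_f_f[OF inj])
  ultimately show ?thesis
    unfolding complex_rel_interior[OF L T(1)] by (intro exI[of _ "u \<circ> ?g"]) simp
qed

lemma carrier_image:
  assumes x: "x \<in> \<Union>K"
  shows "f ` vertices (carrier_simplex K x) = vertices (carrier_simplex L (f x))"
proof -
  note c = carrier_simplex[OF K x]
  obtain T where T: "T \<in> L" "f ` vertices (carrier_simplex K x) = vertices T"
    using image_vertices[OF c(1)] .
  then show ?thesis
    using carrier_simplex_eq[OF L T(1)] rel_interior_image[OF c(1) T c(2)] by simp
qed

lemma inj_on_carrier: "x \<in> \<Union>K \<Longrightarrow> inj_on f (vertices (carrier_simplex K x))"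
  using carrier_simplex[OF K] inj_on_simplex_vertices by blast

text \<open>Injectivity keeps the number of vertices, hence the uniform weights.\<close>

lemma barycenter_image:
  assumes S: "S \<in> K" "vertices S \<noteq> {}"
  shows "f (barycenter (vertices S)) = barycenter (f ` vertices S)"
proof -
  note inj = inj_on_simplex_vertices[OF S(1)]
  have "0 < card (vertices S)"
    using S complex_vertices(3)[OF K S(1)] by (simp add: card_gt_0_iff)
  then show ?thesis
    unfolding barycenter_def
    by (subst simplex_map_sum[OF S(1)]) (auto simp: sum.reindex[OF inj] card_image[OF inj])
qed

lemma carrier_barycenter:
  assumes "S \<in> K" "vertices S \<noteq> {}"
  shows "barycenter (vertices S) \<in> \<Union>K" "carrier_simplex K (barycenter (vertices S)) = S"
  using barycenter_rel_interior[OF K assms] carrier_simplex_eq[OF K] assms(1) rel_interior_subset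
  by blast+

text \<open>On a simplex, the graph of \<open>f\<close> is the convex hull of finitely many points, hence closed.\<close>

lemma continuous_on_simplex:
  assumes S: "S \<in> K"
  shows "continuous_on S f"
proof -
  let ?V = "vertices S"
  let ?p = "\<lambda>x. (x, f x)"
  note V = complex_vertices[OF K S]
  obtain T where T: "T \<in> L" "f ` ?V = vertices T"
    using image_vertices[OF S] .
  have fsum: "f (\<Sum>v\<in>?V. u v *\<^sub>R v) = (\<Sum>v\<in>?V. u v *\<^sub>R f v)"
    if "\<forall>v\<in>?V. 0 \<le> u v" "sum u ?V = 1" for u
    using simplex_map_sum[OF S] that by blast
  have S_eq: "S = {y. \<exists>u. (\<forall>v\<in>?V. 0 \<le> u v) \<and> sum u ?V = 1 \<and> (\<Sum>v\<in>?V. u v *\<^sub>R v) = y}"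
    using V(2) convex_hull_finite[OF V(3)] by simp
  have fS: "f x \<in> convex hull (f ` ?V)" if "x \<in> S" for x
  proof -
    obtain u where u: "\<forall>v\<in>?V. 0 \<le> u v" "sum u ?V = 1" "(\<Sum>v\<in>?V. u v *\<^sub>R v) = x"
      using \<open>x \<in> S\<close> S_eq by blast
    then have "f x = (\<Sum>v\<in>?V. u v *\<^sub>R f v)" using fsum by blast
    then show ?thesis
      using u V(3) by (simp add: convex_sum hull_inc)
  qed
  have "?p ` S = convex hull (?p ` ?V)"
  proof (intro equalityI subsetI)
    fix z assume "z \<in> ?p ` S"
    then obtain x where x: "x \<in> S" "z = (x, f x)" by blast
    obtain u where u: "\<forall>v\<in>?V. 0 \<le> u v" "sum u ?V = 1" "(\<Sum>v\<in>?V. u v *\<^sub>R v) = x"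
      using x S_eq by blast
    have "z = (\<Sum>v\<in>?V. u v *\<^sub>R (v, f v))"
      using x u fsum[OF u(1,2)] by (simp add: scaleR_Pair sum_prod)
    then show "z \<in> convex hull (?p ` ?V)"
      using u V(3) by (simp del: scaleR_Pair add: convex_sum hull_inc)
  next
    fix z assume "z \<in> convex hull (?p ` ?V)"
    \<comment> \<open>Coordinates in the hull are indexed by points of the graph; injectivity moves
      the index to the vertices themselves.\<close>
    moreover have "inj_on ?p ?V" by (rule inj_onI) simp
    ultimately obtain u where u: "\<forall>v\<in>?V. 0 \<le> u (?p v)" "(\<Sum>v\<in>?V. u (?p v)) = 1"
      "(\<Sum>v\<in>?V. u (?p v) *\<^sub>R ?p v) = z"
      using V(3) by (auto simp: convex_hull_finite sum.reindex)
    let ?x = "\<Sum>v\<in>?V. u (?p v) *\<^sub>R v"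
    have "?x \<in> S"
      using convex_sum[OF V(3,4), of "u \<circ> ?p" "\<lambda>v. v"] u vertices_subset[OF S] by auto
    moreover have "f ?x = (\<Sum>v\<in>?V. u (?p v) *\<^sub>R f v)" using fsum[of "u \<circ> ?p"] u by simp
    ultimately show "z \<in> ?p ` S"
      using u(3) by (intro image_eqI[of _ _ ?x]) (auto simp: scaleR_Pair sum_prod)
  qed
  then have "closed (?p ` S)"
    using V(3) by (simp add: compact_imp_closed finite_imp_compact_convex_hull)
  \<comment> \<open>A closed graph yields continuity when the values stay in a compact set; the hull
    of the image vertices is one.\<close>
  moreover have "compact (convex hull (f ` ?V))"
    using V(3) by (simp add: finite_imp_compact_convex_hull)
  ultimately show ?thesis
    using fS by (intro continuous_from_closed_graph) auto
qed

text \<open>Local finiteness enters here: continuous pieces on a locally finite closed cover glue.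
  Continuity is what lets the equations \<open>f (x i) = f (x j)\<close> pass to the closure in
  \<open>D_space\<close>.\<close>

lemma continuous_on_complex: "continuous_on (\<Union>K) f"
proof -
  have lf: "locally_finite_in (top_of_set (\<Union>K)) K"
    using K unfolding locally_finite_complex_def by blast
  have "continuous_map (top_of_set (\<Union>K)) euclidean f"
  proof (rule pasting_lemma_locally_finite[where I = K and T = "\<lambda>S. S" and f = "\<lambda>_. f"])
    show "\<exists>V. openin (top_of_set (\<Union>K)) V \<and> x \<in> V \<and> finite {S \<in> K. S \<inter> V \<noteq> {}}"
      if "x \<in> topspace (top_of_set (\<Union>K))" for x
      using lf that unfolding locally_finite_in_def by blast
    fix S assume S: "S \<in> K"
    show "closedin (top_of_set (\<Union>K)) S"
      using complex_vertices(5)[OF K S] S by (intro closed_subset) (auto simp: compact_imp_closed)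
    have "\<Union>K \<inter> S = S" using S by blast
    then show "continuous_map (subtopology (top_of_set (\<Union>K)) S) euclidean f"
      using continuous_on_simplex[OF S] by (simp add: subtopology_subtopology)
  qed auto
  then show ?thesis by simp
qed

end

section \<open>The associated triangulation\<close>

text \<open>A segment through a point of \<open>V\<close> projects, in each component, to a segment
  or a point inside \<open>S l\<close>; extremality of the component forces a point, so the segment
  is degenerate.\<close>

lemma vertices_hull_of_tuples:
  fixes V :: "(nat \<Rightarrow> 'a::real_vector) set"
  assumes V: "V \<subseteq> tuples k UNIV" and S: "\<And>l. l \<in> {1..k} \<Longrightarrow> convex (S l)"
    and ext: "\<And>v l. v \<in> V \<Longrightarrow> l \<in> {1..k} \<Longrightarrow> v l extreme_point_of S l"
  shows "vertices (convex hull V) = V"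
proof
  show "vertices (convex hull V) \<subseteq> V"
    unfolding vertices_def by (rule extreme_points_of_convex_hull)
  \<comment> \<open>A convex box around the hull: the components of arbitrary hull points lie in
    \<open>S l\<close> and vanish outside \<open>{1..k}\<close>.\<close>
  let ?P = "{z \<in> tuples k UNIV. \<forall>l\<in>{1..k}. z l \<in> S l}"
  have "convex ?P"
    using S unfolding convex_alt tuples_def by (auto simp: scaleR_fun_def)
  moreover have "V \<subseteq> ?P"
    using V ext unfolding extreme_point_of_def by blast
  ultimately have hull: "convex hull V \<subseteq> ?P"
    by (rule hull_minimal[rotated])
  show "V \<subseteq> vertices (convex hull V)"
  proof
    fix v assume v: "v \<in> V"
    have "v \<notin> open_segment a b" if a: "a \<in> convex hull V" and b: "b \<in> convex hull V" for a b
    proof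
      assume "v \<in> open_segment a b"
      then obtain t where t: "0 < t" "t < 1" "v = (1 - t) *\<^sub>R a + t *\<^sub>R b" and "a \<noteq> b"
        unfolding in_segment by blast
      have "a l = b l" for l
      proof (cases "l \<in> {1..k}")
        case True
        have "a l \<in> S l" "b l \<in> S l" using a b hull True by auto
        then have "v l \<notin> open_segment (a l) (b l)"
          using ext[OF v True] unfolding extreme_point_of_def by blast
        moreover have "v l = (1 - t) *\<^sub>R a l + t *\<^sub>R b l"
          using t by (simp add: scaleR_fun_def)
        ultimately show ?thesis
          using t(1,2) by (auto simp: in_segment)
      next
        case False
        moreover have "a \<in> tuples k UNIV" "b \<in> tuples k UNIV" using a b hull by auto
        ultimately show ?thesis by (simp add: tuples_def)
      qed
      with \<open>a \<noteq> b\<close> show False by auto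
    qed
    then show "v \<in> vertices (convex hull V)"
      using v by (auto simp: vertices_def extreme_point_of_def hull_inc)
  qed
qed

section \<open>Forgetting components, and columns of a list of tuples\<close>

lemma forget_tuples:
  assumes "x \<in> tuples k A" "i \<in> {1..k}"
  shows "forget i x \<in> tuples (k - 1) A"
  using assms unfolding tuples_def forget_def by auto

lemma affine_map_on_forget: "affine_map_on S (forget i :: (nat \<Rightarrow> 'a::real_vector) \<Rightarrow> _)"
  by (auto simp: affine_map_on_def forget_def scaleR_fun_def)

lemma affine_map_on_untuple_forget:
  "affine_map_on S (untuple \<circ> forget i :: (nat \<Rightarrow> 'a::real_vector) \<Rightarrow> _)"
  by (auto simp: affine_map_on_def forget_def untuple_def scaleR_fun_def)

lemma continuous_on_component:
  "continuous_on S (\<lambda>x :: nat \<Rightarrow> 'a::topological_space. x i)"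
  by (rule continuous_on_subset[OF continuous_on_product_coordinates subset_UNIV])

text \<open>A list of tuples is read as a matrix: its entries are the rows, one for each vertex of a
  simplex of W^k, and its columns are lists of points of X.\<close>

definition column :: "nat \<Rightarrow> (nat \<Rightarrow> 'a) list \<Rightarrow> 'a list" where
  "column l g = map (\<lambda>v. v l) g"

lemma length_column [simp]: "length (column l g) = length g"
  by (simp add: column_def)

lemma set_column: "set (column l g) = (\<lambda>v. v l) ` set g"
  by (simp add: column_def)

section \<open>Vertices of the associated simplices and projections between the spaces\<close>

context finite_to_one_simplicial_map
begin

definition assoc_vertices :: "nat \<Rightarrow> (nat \<Rightarrow> 'a) \<Rightarrow> (nat \<Rightarrow> 'a) set" where
  "assoc_vertices k x = {v \<in> tuples k (\<Union>K). \<exists>w\<in>vertices (carrier_simplex L (f (x 1))).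
        \<forall>l\<in>{1..k}. v l \<in> vertices (carrier_simplex K (x l)) \<and> f (v l) = w}"

lemma W_space_component:
  assumes "x \<in> W_space f (\<Union>K) k" "l \<in> {1..k}"
  shows "x l \<in> \<Union>K" "f (x l) = f (x 1)"
proof -
  have "1 \<in> {1..k}" using assms(2) by simp
  then show "x l \<in> \<Union>K" "f (x l) = f (x 1)"
    using assms unfolding W_space_def tuples_def by blast+
qed

lemma vertices_component:
  assumes "x \<in> W_space f (\<Union>K) k" "l \<in> {1..k}"
  shows "f ` vertices (carrier_simplex K (x l)) = vertices (carrier_simplex L (f (x 1)))"
    "inj_on f (vertices (carrier_simplex K (x l)))"
  using carrier_image inj_on_carrier W_space_component[OF assms] by force+

lemma vertices_assoc_simplex:
  assumes x: "x \<in> W_space f (\<Union>K) k"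
  shows "vertices (assoc_simplex K L f k x) = assoc_vertices k x"
proof -
  have "vertices (convex hull (assoc_vertices k x)) = assoc_vertices k x"
  proof (rule vertices_hull_of_tuples)
    show "assoc_vertices k x \<subseteq> tuples k UNIV"
      by (auto simp: assoc_vertices_def tuples_def)
    show "convex (carrier_simplex K (x l))" if "l \<in> {1..k}" for l
      using complex_vertices(4)[OF K] carrier_simplex(1)[OF K] W_space_component[OF x that] by blast
    show "v l extreme_point_of carrier_simplex K (x l)"
      if "v \<in> assoc_vertices k x" "l \<in> {1..k}" for v l
      using that by (auto simp: assoc_vertices_def vertices_def)
  qed
  then show ?thesis
    unfolding assoc_simplex_def assoc_vertices_def .
qed

lemma assoc_vertex_over:
  assumes x: "x \<in> W_space f (\<Union>K) k" and w: "w \<in> vertices (carrier_simplex L (f (x 1)))"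
  shows "\<exists>v\<in>assoc_vertices k x. \<forall>l\<in>{1..k}. f (v l) = w"
proof -
  define v where
    "v = (\<lambda>l. if l \<in> {1..k} then inv_into (vertices (carrier_simplex K (x l))) f w else 0)"
  have *: "v l \<in> vertices (carrier_simplex K (x l)) \<and> f (v l) = w" if "l \<in> {1..k}" for l
    using w that vertices_component(1)[OF x that] by (simp add: v_def inv_into_into f_inv_into_f)
  moreover have "v l \<in> \<Union>K" if "l \<in> {1..k}" for l
    using * [OF that] vertices_subset carrier_simplex(1)[OF K] W_space_component[OF x that] by blast
  ultimately have "v \<in> assoc_vertices k x"
    unfolding assoc_vertices_def tuples_def using w * by (auto simp: v_def)
  with * show ?thesis by blast
qed

text \<open>The image of one component is the image of all, and \<open>f\<close> is injective on the
  vertices of each carrier; so a single component already determines the vertex.\<close>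

lemma assoc_vertices_eqI:
  assumes x: "x \<in> W_space f (\<Union>K) k"
    and v: "v \<in> assoc_vertices k x" "v' \<in> assoc_vertices k x" and l: "l \<in> {1..k}" "f (v l) = f (v' l)"
  shows "v = v'"
proof
  fix m
  show "v m = v' m"
  proof (cases "m \<in> {1..k}")
    case True
    have "f (v m) = f (v' m)" using v l True unfolding assoc_vertices_def by auto
    then show ?thesis
      using v vertices_component(2)[OF x True] True unfolding assoc_vertices_def inj_on_def by blast
  next
    case False
    then show ?thesis using v unfolding assoc_vertices_def tuples_def by auto
  qed
qed

text \<open>A vertex \<open>u\<close> of one carrier is completed to a tuple by taking the vertex
  over \<open>f u\<close>; injectivity on that carrier returns \<open>u\<close> in position
  \<open>l\<close>.\<close>

lemma assoc_vertices_component: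
  assumes x: "x \<in> W_space f (\<Union>K) k" and l: "l \<in> {1..k}"
  shows "(\<lambda>v. v l) ` assoc_vertices k x = vertices (carrier_simplex K (x l))"
proof (intro equalityI subsetI)
  fix u assume "u \<in> (\<lambda>v. v l) ` assoc_vertices k x"
  then show "u \<in> vertices (carrier_simplex K (x l))"
    using l unfolding assoc_vertices_def by blast
next
  fix u assume u: "u \<in> vertices (carrier_simplex K (x l))"
  then have "f u \<in> vertices (carrier_simplex L (f (x 1)))"
    using vertices_component(1)[OF x l] by blast
  then obtain v where v: "v \<in> assoc_vertices k x" "f (v l) = f u"
    using assoc_vertex_over[OF x] l by blast
  then have "v l = u"
    using u l vertices_component(2)[OF x l] unfolding assoc_vertices_def inj_on_def by blast
  with v show "u \<in> (\<lambda>v. v l) ` assoc_vertices k x" by blast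
qed

lemma forget_W_space:
  assumes x: "x \<in> W_space f (\<Union>K) k" and i: "i \<in> {1..k}"
  shows "forget i x \<in> W_space f (\<Union>K) (k - 1)"
proof -
  have "f (forget i x l) = f (x 1)" if "l \<in> {1..k-1}" for l
    using that i W_space_component(2)[OF x, of l] W_space_component(2)[OF x, of "Suc l"]
    by (auto simp: forget_def)
  moreover have "forget i x \<in> tuples (k - 1) (\<Union>K)"
    using x forget_tuples[OF _ i] unfolding W_space_def by blast
  ultimately show ?thesis
    unfolding W_space_def by simp
qed

text \<open>Surjectivity comes from uniqueness: a given vertex over \<open>w\<close> and the
  projection of a vertex over \<open>w\<close> have a component with the same image, hence coincide.
  The bound \<open>2 \<le> k\<close> leaves a component for this comparison.\<close>

lemma forget_assoc_vertices:
  assumes x: "x \<in> W_space f (\<Union>K) k" and k: "2 \<le> k" and i: "i \<in> {1..k}"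
  shows "forget i ` assoc_vertices k x = assoc_vertices (k - 1) (forget i x)"
proof -
  note fx = forget_W_space[OF x i]
  \<comment> \<open>If the first component is forgotten, the second takes its place as the point
    that determines the carrier in Y.\<close>
  have f1: "f (forget i x 1) = f (x 1)"
    using k W_space_component(2)[OF x, of 2] by (auto simp: forget_def numeral_2_eq_2)
  have sub: "forget i v \<in> assoc_vertices (k - 1) (forget i x)" if "v \<in> assoc_vertices k x" for v
  proof -
    obtain w where w: "w \<in> vertices (carrier_simplex L (f (x 1)))"
        "\<forall>l\<in>{1..k}. v l \<in> vertices (carrier_simplex K (x l)) \<and> f (v l) = w"
      and v: "v \<in> tuples k (\<Union>K)"
      using \<open>v \<in> _\<close> unfolding assoc_vertices_def by blast
    have "forget i v l \<in> vertices (carrier_simplex K (forget i x l)) \<and> f (forget i v l) = w"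
      if "l \<in> {1..k-1}" for l
      using that i w(2) by (auto simp: forget_def)
    then show ?thesis
      using w(1) forget_tuples[OF v i] f1 unfolding assoc_vertices_def by auto
  qed
  moreover have "v' \<in> forget i ` assoc_vertices k x"
    if v': "v' \<in> assoc_vertices (k - 1) (forget i x)" for v'
  proof -
    obtain w where w: "w \<in> vertices (carrier_simplex L (f (x 1)))" "\<forall>l\<in>{1..k-1}. f (v' l) = w"
      using v' f1 unfolding assoc_vertices_def by auto
    obtain v where v: "v \<in> assoc_vertices k x" "\<forall>l\<in>{1..k}. f (v l) = w"
      using assoc_vertex_over[OF x w(1)] by blast
    have "1 \<in> {1..k-1}" using k by auto
    moreover have "f (forget i v 1) = w"
      using v(2) k by (auto simp: forget_def numeral_2_eq_2)
    ultimately have "v' = forget i v"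
      using assoc_vertices_eqI[OF fx v' sub[OF v(1)], of 1] w(2) by simp
    with v show ?thesis by blast
  qed
  ultimately show ?thesis by blast
qed

text \<open>The equations defining \<open>W_space\<close> are closed conditions because
  \<open>f\<close> is continuous on X.\<close>

lemma D_space_subset: "D_space f (\<Union>K) k \<subseteq> W_space f (\<Union>K) k"
proof -
  let ?T = "tuples k (\<Union>K)" and ?U = "{x \<in> W_space f (\<Union>K) k. inj_on x {1..k}}"
  have "f (x i) = f (x j)" if x: "x \<in> ?T" "x \<in> closure ?U" and ij: "i \<in> {1..k}" "j \<in> {1..k}" for x i j
  proof -
    have cont: "continuous_on ?T (\<lambda>z. f (z m))" if "m \<in> {1..k}" for m
      by (rule continuous_on_compose2[OF continuous_on_complex continuous_on_component])
        (use that in \<open>auto simp: tuples_def\<close>)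
    have "continuous_on ?T (\<lambda>z. f (z i) - f (z j))"
      using cont ij by (intro continuous_on_diff)
    then have "closedin (top_of_set ?T) (?T \<inter> (\<lambda>z. f (z i) - f (z j)) -` {0})"
      by (rule continuous_closedin_preimage) simp
    \<comment> \<open>Continuity is known only on X, whereas the closure is taken in the whole
      product space; a closed \<open>C\<close> that cuts out the relatively closed set bridges the
      two.\<close>
    then obtain C where C: "closed C" "?T \<inter> (\<lambda>z. f (z i) - f (z j)) -` {0} = ?T \<inter> C"
      by (auto simp: closedin_closed)
    have "?U \<subseteq> C"
    proof
      fix z assume z: "z \<in> ?U"
      then have "z \<in> ?T" "f (z i) = f (z j)"
        using ij unfolding W_space_def by blast+
      then have "z \<in> ?T \<inter> (\<lambda>z. f (z i) - f (z j)) -` {0}" by simp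
      then show "z \<in> C" unfolding C(2) by blast
    qed
    then have "closure ?U \<subseteq> C" using C(1) closure_minimal by blast
    then have "x \<in> ?T \<inter> (\<lambda>z. f (z i) - f (z j)) -` {0}" using x unfolding C(2) by blast
    then show ?thesis by simp
  qed
  then show ?thesis unfolding D_space_def W_space_def by blast
qed

text \<open>\<open>forget i\<close> is continuous and keeps injective tuples injective, so it
  respects the two closures.\<close>

lemma forget_D_space:
  assumes i: "i \<in> {1..k}"
  shows "forget i ` D_space f (\<Union>K) k \<subseteq> D_space f (\<Union>K) (k - 1)"
proof -
  let ?U = "\<lambda>k. {x \<in> W_space f (\<Union>K) k. inj_on x {1..k}}"
  have "continuous_on UNIV (\<lambda>x :: nat \<Rightarrow> 'a. forget i x)"
  proof (rule continuous_on_coordinatewise_then_product)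
    show "continuous_on UNIV (\<lambda>x :: nat \<Rightarrow> 'a. forget i x l)" for l
      by (cases "l < i") (simp_all add: forget_def)
  qed
  then have cont: "continuous_on S (\<lambda>x :: nat \<Rightarrow> 'a. forget i x)" for S
    using continuous_on_subset by blast
  have "inj_on (forget i x) {1..k-1}" if "inj_on x {1..k}" for x :: "nat \<Rightarrow> 'a"
  proof -
    let ?s = "\<lambda>l. if l < i then l else Suc l"
    have "inj_on ?s {1..k-1}" "?s ` {1..k-1} \<subseteq> {1..k}"
      by (auto simp: inj_on_def)
    then have "inj_on (x \<circ> ?s) {1..k-1}"
      using that by (meson comp_inj_on inj_on_subset)
    then show ?thesis by (simp add: comp_def forget_def if_distrib)
  qed
  then have "forget i ` ?U k \<subseteq> ?U (k - 1)"
    using forget_W_space[OF _ i] by blast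
  then have "forget i ` closure (?U k) \<subseteq> closure (?U (k - 1))"
    using closure_subset by (intro image_closure_subset[OF cont]) fastforce+
  then show ?thesis
    using forget_tuples[OF _ i] unfolding D_space_def by blast
qed

text \<open>Stated for general \<open>Z\<close> and \<open>Z'\<close> so that one argument serves
  both W^k and D^k.\<close>

lemma simplicial_forget:
  assumes Z: "Z \<subseteq> W_space f (\<Union>K) k" "forget i ` Z \<subseteq> Z'" and k: "2 \<le> k" "i \<in> {1..k}"
  shows "simplicial_map (assoc_simplex K L f k ` Z) (assoc_simplex K L f (k - 1) ` Z') (forget i)"
  unfolding simplicial_map_def
proof (intro ballI conjI affine_map_on_forget)
  fix S assume "S \<in> assoc_simplex K L f k ` Z"
  then obtain x where x: "x \<in> Z" "S = assoc_simplex K L f k x" by blast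
  then have "x \<in> W_space f (\<Union>K) k" using Z by blast
  then have "forget i ` vertices S = vertices (assoc_simplex K L f (k - 1) (forget i x))"
    using x k vertices_assoc_simplex forget_W_space forget_assoc_vertices by simp
  then show "\<exists>T\<in>assoc_simplex K L f (k - 1) ` Z'. forget i ` vertices S = vertices T"
    using x Z by blast
qed

lemma simplicial_untuple_forget:
  assumes Z: "Z \<subseteq> W_space f (\<Union>K) 2" and i: "i \<in> {1..2}"
  shows "simplicial_map (assoc_simplex K L f 2 ` Z) K (untuple \<circ> forget i)"
  unfolding simplicial_map_def
proof (intro ballI conjI affine_map_on_untuple_forget)
  fix S assume "S \<in> assoc_simplex K L f 2 ` Z"
  then obtain x where x: "x \<in> W_space f (\<Union>K) 2" "S = assoc_simplex K L f 2 x" using Z by blast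
  note fx = forget_W_space[OF x(1) i]
  have 1: "1 \<in> {1..2 - 1 :: nat}" by simp
  have "(untuple \<circ> forget i) ` vertices S = (\<lambda>v. v 1) ` forget i ` assoc_vertices 2 x"
    unfolding x(2) vertices_assoc_simplex[OF x(1)] by (simp add: image_comp comp_def untuple_def)
  also have "\<dots> = vertices (carrier_simplex K (forget i x 1))"
    unfolding forget_assoc_vertices[OF x(1) order_refl i] by (rule assoc_vertices_component[OF fx 1])
  finally show "\<exists>T\<in>K. (untuple \<circ> forget i) ` vertices S = vertices T"
    using carrier_simplex(1)[OF K W_space_component(1)[OF fx 1]] by blast
qed

text \<open>The k-fold fibre product of the ordered simplices of X over those of Y, in matrix form.
  Images are compared as lists, so corresponding vertices are matched; column 1 is the
  reference.\<close>

definition fibre_power :: "nat \<Rightarrow> nat \<Rightarrow> (nat \<Rightarrow> 'a) list set" where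
  "fibre_power n k = {g. set g \<subseteq> tuples k UNIV \<and>
     (\<forall>l\<in>{1..k}. column l g \<in> ordered_simplices n K \<and> map f (column l g) = map f (column 1 g))}"

lemma fibre_power_column:
  assumes "g \<in> fibre_power n k" "l \<in> {1..k}"
  shows "column l g \<in> ordered_simplices n K" "map f (column l g) = map f (column 1 g)"
  using assms unfolding fibre_power_def by blast+

lemma inj_on_ordered_simplex: "s \<in> ordered_simplices n K \<Longrightarrow> inj_on f (set s)"
  using inj_on_simplex_vertices unfolding ordered_simplices_def by auto

lemma ordered_simplices_W_subset:
  assumes k: "1 \<le> k"
  shows "ordered_simplices n (W_complex K L f k) \<subseteq> fibre_power n k"
proof
  fix g assume "g \<in> ordered_simplices n (W_complex K L f k)"
  then obtain x where x: "x \<in> W_space f (\<Union>K) k" and g: "length g = n + 1" "distinct g"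
      "set g = assoc_vertices k x"
    unfolding ordered_simplices_def W_complex_def by (auto simp: vertices_assoc_simplex)
  have 1: "1 \<in> {1..k}" using k by simp
  have "set g \<subseteq> tuples k UNIV"
    unfolding g assoc_vertices_def tuples_def by auto
  moreover have "column l g \<in> ordered_simplices n K" if l: "l \<in> {1..k}" for l
  proof -
    have "inj_on (\<lambda>v. v l) (set g)"
      using assoc_vertices_eqI[OF x _ _ l] unfolding g by (intro inj_onI) simp
    then have "distinct (column l g)"
      using g(2) by (simp add: column_def distinct_map)
    moreover have "set (column l g) = vertices (carrier_simplex K (x l))"
      using assoc_vertices_component[OF x l] by (simp add: set_column g)
    moreover have "carrier_simplex K (x l) \<in> K"
      using carrier_simplex(1)[OF K] W_space_component[OF x l] by blast
    ultimately show ?thesis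
      using g(1) unfolding ordered_simplices_def by auto
  qed
  moreover have "map f (column l g) = map f (column 1 g)" if l: "l \<in> {1..k}" for l
    using l 1 g(3) by (auto simp: column_def assoc_vertices_def)
  ultimately show "g \<in> fibre_power n k"
    unfolding fibre_power_def by blast
qed

text \<open>Columns with the same image have barycenters with the same image, so these form a point
  of \<open>W_space\<close> whose carriers are spanned by the columns. The singleton complex in the
  conclusion lets the result serve \<open>W_complex\<close> and \<open>D_complex\<close>
  alike.\<close>

lemma fibre_power_realization:
  assumes k: "1 \<le> k" and g: "g \<in> fibre_power n k"
  defines "x \<equiv> \<lambda>l. if l \<in> {1..k} then barycenter (set (column l g)) else 0"
  shows "x \<in> W_space f (\<Union>K) k" "g \<in> ordered_simplices n {assoc_simplex K L f k x}"
    "\<And>l. l \<in> {1..k} \<Longrightarrow> vertices (carrier_simplex K (x l)) = set (column l g)"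
proof -
  have 1: "1 \<in> {1..k}" using k by simp
  note col = fibre_power_column[OF g]
  have "\<exists>S. \<forall>l\<in>{1..k}. S l \<in> K \<and> set (column l g) = vertices (S l)"
    using col(1) unfolding ordered_simplices_def by (intro bchoice) blast
  then obtain S where S: "\<And>l. l \<in> {1..k} \<Longrightarrow> S l \<in> K"
      "\<And>l. l \<in> {1..k} \<Longrightarrow> set (column l g) = vertices (S l)"
    by blast
  have len: "length g = n + 1"
    using col(1)[OF 1] unfolding ordered_simplices_def by simp
  then have ne: "set (column l g) \<noteq> {}" for l
    by (auto simp: column_def)
  have xl: "x l \<in> \<Union>K" "carrier_simplex K (x l) = S l" "f (x l) = barycenter (f ` set (column 1 g))"
    if l: "l \<in> {1..k}" for l
  proof -
    have ne': "vertices (S l) \<noteq> {}" using ne S(2)[OF l] by metis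
    have x: "x l = barycenter (vertices (S l))" using l S(2)[OF l] by (simp add: x_def)
    show "x l \<in> \<Union>K" "carrier_simplex K (x l) = S l"
      unfolding x using carrier_barycenter[OF S(1)[OF l] ne'] by auto
    have "f ` set (column l g) = f ` set (column 1 g)"
      using arg_cong[OF col(2)[OF l], of set] by simp
    then show "f (x l) = barycenter (f ` set (column 1 g))"
      unfolding x using barycenter_image[OF S(1)[OF l] ne'] S(2)[OF l] by simp
  qed
  show x: "x \<in> W_space f (\<Union>K) k"
    using xl(1,3) unfolding W_space_def tuples_def by (auto simp: x_def)
  show vert: "vertices (carrier_simplex K (x l)) = set (column l g)" if "l \<in> {1..k}" for l
    using xl(2)[OF that] S(2)[OF that] by simp
  have inj: "inj_on f (set (column 1 g))"
    using inj_on_ordered_simplex col(1)[OF 1] .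
  have fcol: "f (v l) = f (v 1)" if "v \<in> set g" "l \<in> {1..k}" for v l
    using col(2)[OF that(2)] that(1) by (simp add: column_def)
  have sub: "set g \<subseteq> assoc_vertices k x"
  proof
    fix v assume v: "v \<in> set g"
    have vl: "v l \<in> vertices (carrier_simplex K (x l))" if "l \<in> {1..k}" for l
      using vert[OF that] v by (simp add: set_column)
    moreover have "v l \<in> \<Union>K" if "l \<in> {1..k}" for l
      using vl[OF that] vertices_subset[OF S(1)[OF that]] xl(2)[OF that] S(1)[OF that] by auto
    moreover have "f (v 1) \<in> vertices (carrier_simplex L (f (x 1)))"
      using vl[OF 1] vertices_component(1)[OF x 1] by blast
    moreover have "\<forall>l. l \<notin> {1..k} \<longrightarrow> v l = 0"
      using g v unfolding fibre_power_def tuples_def by blast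
    ultimately show "v \<in> assoc_vertices k x"
      using fcol[OF v] unfolding assoc_vertices_def tuples_def by blast
  qed
  \<comment> \<open>Conversely, a vertex is determined by its first component, which occurs in some
    row of \<open>g\<close>.\<close>
  moreover have "v \<in> set g" if v: "v \<in> assoc_vertices k x" for v
  proof -
    have "v 1 \<in> set (column 1 g)"
      using v 1 vert[OF 1] unfolding assoc_vertices_def by auto
    then obtain v' where v': "v' \<in> set g" "v 1 = v' 1" by (auto simp: set_column)
    then have "v = v'"
      using assoc_vertices_eqI[OF x v _ 1] sub by auto
    with v' show ?thesis by simp
  qed
  ultimately have "set g = vertices (assoc_simplex K L f k x)"
    using vertices_assoc_simplex[OF x] by blast
  moreover have "distinct g"
    using col(1)[OF 1] unfolding ordered_simplices_def column_def by (auto simp: distinct_map)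
  ultimately show "g \<in> ordered_simplices n {assoc_simplex K L f k x}"
    using len unfolding ordered_simplices_def by auto
qed

lemma ordered_simplices_W:
  assumes k: "1 \<le> k"
  shows "ordered_simplices n (W_complex K L f k) = fibre_power n k"
  using ordered_simplices_W_subset[OF k] fibre_power_realization(1,2)[OF k]
  unfolding ordered_simplices_def W_complex_def by blast

lemma ordered_simplices_D_subset:
  assumes k: "1 \<le> k"
  shows "ordered_simplices n (D_complex K L f k) \<subseteq> fibre_power n k"
proof -
  have "D_complex K L f k \<subseteq> W_complex K L f k"
    unfolding D_complex_def W_complex_def by (intro image_mono D_space_subset)
  then show ?thesis
    using ordered_simplices_W[OF k] unfolding ordered_simplices_def by blast
qed

text \<open>Distinct ordered simplices with the same image have distinct barycenters.\<close>

lemma ordered_simplices_D_injective: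
  assumes k: "1 \<le> k" and g: "g \<in> fibre_power n k" and inj: "inj_on (\<lambda>l. column l g) {1..k}"
  shows "g \<in> ordered_simplices n (D_complex K L f k)"
proof -
  define x where "x = (\<lambda>l. if l \<in> {1..k} then barycenter (set (column l g)) else 0)"
  note r = fibre_power_realization(1,2)[OF k g, folded x_def]
  have vert: "vertices (carrier_simplex K (x l)) = set (column l g)" if "l \<in> {1..k}" for l
    using fibre_power_realization(3)[OF k g that] by (simp only: x_def)
  have "inj_on x {1..k}"
  proof (rule inj_onI)
    fix i j assume ij: "i \<in> {1..k}" "j \<in> {1..k}" "x i = x j"
    then have "set (column i g) = set (column j g)" using vert[OF ij(1)] vert[OF ij(2)] by simp
    moreover have "map f (column i g) = map f (column j g)"
      using fibre_power_column(2)[OF g ij(1)] fibre_power_column(2)[OF g ij(2)] by simp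
    \<comment> \<open>Equal barycenters give equal carriers and so equal vertex sets; the order is
      recovered from the common image list, as \<open>f\<close> is injective there.\<close>
    ultimately have "column i g = column j g"
      using inj_on_ordered_simplex[OF fibre_power_column(1)[OF g ij(1)]] by (simp add: map_inj_on)
    then show "i = j" using inj ij unfolding inj_on_def by blast
  qed
  \<comment> \<open>An injective tuple lies in the set whose closure is taken, so no limit is
    involved.\<close>
  then have "x \<in> D_space f (\<Union>K) k"
    using r(1) closure_subset unfolding D_space_def W_space_def by fastforce
  then show ?thesis
    using r(2) unfolding ordered_simplices_def D_complex_def by blast
qed

text \<open>Surjectivity on points suffices: the carrier of any preimage of the barycenter maps
  bijectively on vertices to the given simplex, and its vertices inherit the order.\<close>

lemma ordered_simplex_lift:
  assumes t: "t \<in> ordered_simplices n L"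
  shows "\<exists>s\<in>ordered_simplices n K. map f s = t"
proof -
  obtain T where T: "T \<in> L" "set t = vertices T" "length t = n + 1" "distinct t"
    using t unfolding ordered_simplices_def by blast
  then have ne: "vertices T \<noteq> {}" by auto
  let ?y = "barycenter (vertices T)"
  have y: "?y \<in> rel_interior T" by (rule barycenter_rel_interior[OF L T(1) ne])
  then have "?y \<in> \<Union>L" using T(1) rel_interior_subset by blast
  then obtain x where x: "x \<in> \<Union>K" "f x = ?y" using surj by (metis imageE)
  let ?S = "carrier_simplex K x"
  have im: "f ` vertices ?S = set t"
    using carrier_image[OF x(1)] carrier_simplex_eq[OF L T(1) y] x(2) T(2) by simp
  let ?s = "map (inv_into (vertices ?S) f) t"
  have "map f ?s = t"
    using im by (simp add: map_idI f_inv_into_f)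
  moreover have "inj_on (inv_into (vertices ?S) f) (set t)"
    using im by (metis inj_on_inv_into order_refl)
  moreover have "set ?s = vertices ?S"
    using inj_on_carrier[OF x(1)] unfolding set_map im[symmetric] by (simp add: inv_into_image_cancel)
  ultimately show ?thesis
    using T carrier_simplex(1)[OF K x(1)] unfolding ordered_simplices_def
    by (intro bexI[of _ ?s]) (auto simp: distinct_map)
qed

lemma map_ordered_simplex:
  assumes s: "s \<in> ordered_simplices n K"
  shows "map f s \<in> ordered_simplices n L"
proof -
  obtain S where S: "S \<in> K" "set s = vertices S" "length s = n + 1" "distinct s"
    using s unfolding ordered_simplices_def by blast
  then show ?thesis
    using inj_on_simplex_vertices[OF S(1)] simplicial
    unfolding ordered_simplices_def simplicial_map_def by (simp add: distinct_map)
qed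

end

section \<open>Chains and antisymmetrization\<close>

text \<open>More general than \<open>push\<close>, whose maps act on each vertex separately:
  appending a lift acts on whole ordered simplices.\<close>

definition frag_map :: "('a \<Rightarrow> 'b) \<Rightarrow> ('a \<Rightarrow>\<^sub>0 int) \<Rightarrow> ('b \<Rightarrow>\<^sub>0 int)" where
  "frag_map \<phi> = frag_extend (frag_of \<circ> \<phi>)"

lemma push_eq: "push g = frag_map (map g)"
  by (simp add: push_def frag_map_def comp_def)

lemma frag_map_0 [simp]: "frag_map \<phi> 0 = 0"
  by (simp add: frag_map_def)

lemma frag_map_of [simp]: "frag_map \<phi> (frag_of x) = frag_of (\<phi> x)"
  by (simp add: frag_map_def)

lemma frag_map_add: "frag_map \<phi> (c + d) = frag_map \<phi> c + frag_map \<phi> d"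
  by (simp add: frag_map_def frag_extend_add)

lemma frag_map_diff: "frag_map \<phi> (c - d) = frag_map \<phi> c - frag_map \<phi> d"
  by (simp add: frag_map_def frag_extend_diff)

lemma frag_map_uminus: "frag_map \<phi> (- c) = - frag_map \<phi> c"
  by (simp add: frag_map_def frag_extend_minus)

lemma frag_map_cmul: "frag_map \<phi> (frag_cmul a c) = frag_cmul a (frag_map \<phi> c)"
  by (simp add: frag_map_def frag_extend_cmul)

lemma frag_map_sum: "finite I \<Longrightarrow> frag_map \<phi> (\<Sum>i\<in>I. c i) = (\<Sum>i\<in>I. frag_map \<phi> (c i))"
  by (simp add: frag_map_def frag_extend_sum comp_def)

lemma frag_map_frag_map: "frag_map \<phi> (frag_map \<psi> c) = frag_map (\<phi> \<circ> \<psi>) c"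
  unfolding frag_map_def frag_extend_compose by (simp add: comp_assoc)

lemma frag_map_cong:
  "(\<And>x. x \<in> Poly_Mapping.keys c \<Longrightarrow> \<phi> x = \<psi> x) \<Longrightarrow> frag_map \<phi> c = frag_map \<psi> c"
  unfolding frag_map_def by (rule frag_extend_eq) simp

lemma frag_map_ident: "(\<And>x. x \<in> Poly_Mapping.keys c \<Longrightarrow> \<phi> x = x) \<Longrightarrow> frag_map \<phi> c = c"
  using frag_map_cong[of c \<phi> "\<lambda>x. x"] frag_expansion[of c] by (simp add: frag_map_def comp_def)

lemma keys_frag_map:
  assumes "Poly_Mapping.keys c \<subseteq> A" "\<And>x. x \<in> A \<Longrightarrow> \<phi> x \<in> B"
  shows "Poly_Mapping.keys (frag_map \<phi> c) \<subseteq> B"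
proof -
  have "Poly_Mapping.keys (frag_map \<phi> c) \<subseteq> (\<Union>x\<in>Poly_Mapping.keys c. {\<phi> x})"
    using keys_frag_extend[of "frag_of \<circ> \<phi>" c] by (simp add: frag_map_def)
  then show ?thesis using assms by blast
qed

lemma lookup_frag_map:
  assumes "inj \<phi>"
  shows "Poly_Mapping.lookup (frag_map \<phi> c) (\<phi> x) = Poly_Mapping.lookup c x"
  using subset_UNIV
proof (induction c rule: frag_induction)
  case (one y)
  then show ?case using assms by (auto simp: inj_def)
qed (simp_all add: frag_map_diff lookup_minus)

lemma keys_frag_sum:
  assumes "\<And>i. i \<in> I \<Longrightarrow> Poly_Mapping.keys (c i) \<subseteq> A"
  shows "Poly_Mapping.keys (\<Sum>i\<in>I. frag_cmul (a i) (c i)) \<subseteq> A"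
  using keys_sum[of "\<lambda>i. frag_cmul (a i) (c i)" I] assms keys_cmul by blast

text \<open>Free abelian groups have no 2-torsion; this turns sign-reversing symmetries into
  vanishing.\<close>

lemma frag_eq_minus_self: "c = - c \<Longrightarrow> c = (0 :: 'a \<Rightarrow>\<^sub>0 int)"
proof (rule poly_mapping_eqI)
  fix x assume "c = - c"
  then have "Poly_Mapping.lookup c x = - Poly_Mapping.lookup c x"
    by (metis lookup_uminus)
  then show "Poly_Mapping.lookup c x = Poly_Mapping.lookup 0 x" by simp
qed

text \<open>The tool for matrix identities below. Every \<open>l\<close> is tested, not only
  \<open>1..k\<close>, so the zero columns are part of each check.\<close>

lemma column_ext: "(\<And>l. column l g = column l h) \<Longrightarrow> g = h"
proof (rule nth_equalityI)
  assume *: "\<And>l. column l g = column l h"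
  then show "length g = length h" by (metis length_column)
  fix m assume m: "m < length g"
  have "(g ! m) l = (h ! m) l" for l
    using arg_cong[OF * [of l], of "\<lambda>xs. xs ! m"] m \<open>length g = length h\<close> by (simp add: column_def)
  then show "g ! m = h ! m" by (rule ext)
qed

lemma column_forget: "column l (map (forget i) g) = (if l < i then column l g else column (Suc l) g)"
  by (simp add: column_def forget_def)

lemma column_permute: "column l (map (permute \<sigma>) g) = column (inv_into UNIV \<sigma> l) g"
  by (simp add: column_def permute_def)

lemma map_untuple: "map untuple g = column 1 g"
  by (simp add: column_def untuple_def)

definition append_column :: "nat \<Rightarrow> (nat \<Rightarrow> 'a) list \<Rightarrow> 'a list \<Rightarrow> (nat \<Rightarrow> 'a) list" where
  "append_column k g s = map2 (\<lambda>v a. v(Suc k := a)) g s"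

lemma column_append:
  assumes "length s = length g"
  shows "column l (append_column k g s) = (if l = Suc k then s else column l g)"
  using assms by (auto simp: append_column_def column_def map_fst_zip map_snd_zip comp_def
      case_prod_beta simp flip: map_map intro!: nth_equalityI)

lemma length_append_column: "length s = length g \<Longrightarrow> length (append_column k g s) = length g"
  by (simp add: append_column_def)

definition tuple1 :: "'a::zero \<Rightarrow> nat \<Rightarrow> 'a" where
  "tuple1 a = (\<lambda>l. if l = 1 then a else 0)"

lemma column_tuple1: "column l (map tuple1 s) = (if l = 1 then s else replicate (length s) 0)"
  by (simp add: column_def tuple1_def comp_def map_replicate_const)

lemma inv_permutes_mem: "\<sigma> permutes S \<Longrightarrow> inv_into UNIV \<sigma> l \<in> S \<longleftrightarrow> l \<in> S"
  using permutes_inv permutes_in_image by metis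

text \<open>The inverse in \<open>permute\<close> is what makes it a left action.\<close>

lemma permute_compose: "bij \<sigma> \<Longrightarrow> bij \<tau> \<Longrightarrow> permute \<sigma> \<circ> permute \<tau> = permute (\<sigma> \<circ> \<tau>)"
  by (simp add: permute_def fun_eq_iff o_inv_distrib)

lemma push_permute_compose:
  "bij \<sigma> \<Longrightarrow> bij \<tau> \<Longrightarrow> push (permute \<sigma>) (push (permute \<tau>) c) = push (permute (\<sigma> \<circ> \<tau>)) c"
  by (simp add: push_eq frag_map_frag_map permute_compose)

lemma permute_id: "permute id = id"
  by (simp add: permute_def fun_eq_iff)

lemma push_id [simp]: "push id c = c"
  by (simp add: push_eq frag_map_ident)

section \<open>The face identities and the alternating sum\<close>

lemma forget_forget: "i \<le> j \<Longrightarrow> forget j \<circ> forget i = forget i \<circ> forget (Suc j)"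
  by (auto simp: forget_def fun_eq_iff)

lemma rho_add: "rho k (c + d) = rho k c + rho k d"
  by (simp add: rho_def push_eq frag_map_add frag_cmul_distrib2 sum.distrib)

lemma rho_2: "rho 2 c = push (forget 1) c - push (forget 2) c"
proof -
  have "{1..2} = {1, 2 :: nat}" by auto
  then show ?thesis by (simp add: rho_def)
qed

lemma rho_rho: "rho k (rho (Suc k) c) = 0"
proof -
  define F where "F = (\<lambda>(j, i). frag_cmul ((-1) ^ (i - 1 + (j - 1))) (push (forget j \<circ> forget i) c))"
  let ?A = "{(j, i). j \<in> {1..k} \<and> i \<in> {1..j}}"
  let ?B = "{(j, i). j \<in> {1..k} \<and> i \<in> {Suc j..Suc k}}"
  have "rho k (rho (Suc k) c) = (\<Sum>j=1..k. \<Sum>i=1..Suc k. F (j, i))"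
    unfolding rho_def push_eq
    by (simp only: frag_map_sum finite_atLeastAtMost frag_map_cmul frag_map_frag_map frag_cmul_sum
        frag_cmul_cmul map_comp_map F_def prod.case push_eq power_add mult.commute)
  also have "\<dots> = sum F ({1..k} \<times> {1..Suc k})"
    by (simp only: sum.cartesian_product split_def prod.collapse)
  also have "{1..k} \<times> {1..Suc k} = ?A \<union> ?B" by auto
  also have "sum F (?A \<union> ?B) = sum F ?A + sum F ?B"
  proof (rule sum.union_disjoint)
    show "finite ?A" "finite ?B"
      by (rule finite_subset[of _ "{1..k} \<times> {1..Suc k}"]; auto)+
  qed auto
  \<comment> \<open>The pair \<open>(j, i)\<close> with \<open>i \<le> j\<close> is matched with
    \<open>(i, j + 1)\<close>: the composites agree by \<open>forget_forget\<close>, and the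
    exponent of the sign grows by one.\<close>
  also have "sum F ?A = (\<Sum>p\<in>?B. - F p)"
  proof (rule sum.reindex_bij_witness[where i = "\<lambda>(j, i). (i - 1, j)" and j = "\<lambda>(j, i). (i, Suc j)"])
    fix p assume p: "p \<in> ?A"
    then obtain j i where ji: "p = (j, i)" "1 \<le> i" "i \<le> j" "j \<le> k" by auto
    then have "Suc j - 1 + (i - 1) = Suc (i - 1 + (j - 1))"
      by auto
    then have "(-1) ^ (Suc j - 1 + (i - 1)) = - ((-1) ^ (i - 1 + (j - 1)) :: int)"
      by (simp only: power_Suc)
    then show "- F (case p of (j, i) \<Rightarrow> (i, Suc j)) = F p"
      using ji by (simp add: F_def forget_forget[OF ji(3)])
  qed auto
  finally show ?thesis by (simp add: sum_negf)
qed

section \<open>Exactness criterion and antisymmetric chains\<close>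

lemma exact_atI:
  assumes "group_hom G H g" "group_hom H M h"
    and "\<And>c. c \<in> carrier G \<Longrightarrow> h (g c) = \<one>\<^bsub>M\<^esub>"
    and "\<And>z. z \<in> carrier H \<Longrightarrow> h z = \<one>\<^bsub>M\<^esub> \<Longrightarrow> \<exists>w\<in>carrier G. g w = z"
  shows "exact_at G g H h M"
  using assms group_hom.hom_closed[OF assms(1)] unfolding exact_at_def kernel_def by blast

abbreviation swap :: "nat \<Rightarrow> nat \<Rightarrow> nat \<Rightarrow> nat" where
  "swap \<equiv> Transposition.transpose"

text \<open>The sign condition is separated from the support, so that it can be used before a chain
  is known to live on D^k.\<close>

definition antisymmetric :: "nat \<Rightarrow> ((nat \<Rightarrow> 'a) list \<Rightarrow>\<^sub>0 int) \<Rightarrow> bool" where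
  "antisymmetric k c \<longleftrightarrow>
     (\<forall>\<sigma>. \<sigma> permutes {1..k} \<longrightarrow> push (permute \<sigma>) c = frag_cmul (sign \<sigma>) c)"

lemma antisymmetricD:
  "antisymmetric k c \<Longrightarrow> \<sigma> permutes {1..k} \<Longrightarrow> push (permute \<sigma>) c = frag_cmul (sign \<sigma>) c"
  by (simp add: antisymmetric_def)

lemma antisymmetric_transpose:
  assumes "antisymmetric k c" "i \<in> {1..k}" "j \<in> {1..k}" "i \<noteq> j"
  shows "push (permute (swap i j)) c = - c"
  using antisymmetricD[OF assms(1) permutes_swap_id[OF assms(2,3)]] assms(4)
  by (simp add: sign_swap_id)

text \<open>The transposition of two equal columns fixes the simplex but changes the sign of its
  coefficient.\<close>

lemma antisymmetric_keys_injective: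
  fixes c :: "(nat \<Rightarrow> 'a) list \<Rightarrow>\<^sub>0 int"
  assumes c: "antisymmetric k c" and g: "g \<in> Poly_Mapping.keys c"
  shows "inj_on (\<lambda>l. column l g) {1..k}"
proof (rule inj_onI, rule ccontr)
  fix i j assume ij: "i \<in> {1..k}" "j \<in> {1..k}" "column i g = column j g" "i \<noteq> j"
  let ?t = "swap i j"
  have inv: "inv_into UNIV ?t = ?t"
    by (rule inv_unique_comp) simp_all
  have "map (permute ?t) g = g"
    by (rule column_ext) (use ij(3) in \<open>auto simp: column_permute inv Transposition.transpose_def\<close>)
  moreover have "permute ?t \<circ> permute ?t = (id :: (nat \<Rightarrow> 'a) \<Rightarrow> _)"
    by (auto simp: permute_def inv fun_eq_iff)
  then have "inj (permute ?t :: (nat \<Rightarrow> 'a) \<Rightarrow> _)"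
    by (metis inj_on_id inj_on_imageI2)
  \<comment> \<open>The action of the transposition is injective and fixes \<open>g\<close>, so the
    push-forward keeps the coefficient at \<open>g\<close>, while antisymmetry negates it.\<close>
  ultimately have "Poly_Mapping.lookup (push (permute ?t) c) g = Poly_Mapping.lookup c g"
    using lookup_frag_map[of "map (permute ?t)" c g] by (simp add: push_eq inj_mapI)
  then have "Poly_Mapping.lookup c g = 0"
    using antisymmetric_transpose[OF c ij(1,2,4)] by simp
  with g show False by (simp add: in_keys_iff)
qed

lemma alternating_chains_eq:
  "alternating_chains n k T = (simplicial_chains n T)\<lparr>carrier :=
     {c \<in> carrier (simplicial_chains n T). antisymmetric k c}\<rparr>"
  by (simp add: alternating_chains_def antisymmetric_def)

lemma group_simplicial_chains: "group (simplicial_chains n T)"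
  by (simp add: simplicial_chains_def)

lemma antisymmetric_add: "antisymmetric k c \<Longrightarrow> antisymmetric k d \<Longrightarrow> antisymmetric k (c + d)"
  by (simp add: antisymmetric_def push_eq frag_map_add frag_cmul_distrib2)

lemma antisymmetric_uminus:
  assumes "antisymmetric k c"
  shows "antisymmetric k (- c)"
proof -
  have "antisymmetric k (frag_cmul (- 1) c)"
    using assms by (simp add: antisymmetric_def push_eq frag_map_cmul mult.commute del: frag_cmul_minus_one)
  then show ?thesis by simp
qed

lemma group_alternating_chains: "group (alternating_chains n k T)"
proof -
  interpret group "simplicial_chains n T" by (rule group_simplicial_chains)
  let ?C = "{c \<in> carrier (simplicial_chains n T). antisymmetric k c}"
  have "subgroup ?C (simplicial_chains n T)"
  proof (rule subgroupI)
    have "antisymmetric k 0"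
      by (simp add: antisymmetric_def push_eq)
    then have "0 \<in> ?C" by (simp add: simplicial_chains_def)
    then show "?C \<noteq> {}" by blast
    show "inv\<^bsub>simplicial_chains n T\<^esub> c \<in> ?C" if "c \<in> ?C" for c
      using that antisymmetric_uminus[of k c] by (simp add: simplicial_chains_def)
    show "c \<otimes>\<^bsub>simplicial_chains n T\<^esub> d \<in> ?C" if "c \<in> ?C" "d \<in> ?C" for c d
      using that antisymmetric_add[of k c d] keys_add[of c d] by (auto simp: simplicial_chains_def)
  qed auto
  then show ?thesis
    unfolding alternating_chains_eq by (rule subgroup_imp_group)
qed

text \<open>For a chain already antisymmetric in the first k components, k + 1 transpositions
  replace the sum over all permutations. The term \<open>i = k + 1\<close> is \<open>u\<close>
  itself with coefficient one.\<close>

definition antisymmetrize :: "nat \<Rightarrow> ((nat \<Rightarrow> 'a) list \<Rightarrow>\<^sub>0 int) \<Rightarrow> ((nat \<Rightarrow> 'a) list \<Rightarrow>\<^sub>0 int)" where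
  "antisymmetrize k u = (\<Sum>i=1..Suc k. frag_cmul (sign (swap i (Suc k)))
     (push (permute (swap i (Suc k))) u))"

text \<open>The transpositions \<open>swap i (k + 1)\<close> are coset representatives of \<open>S\<^sub>k\<close> in \<open>S\<^sub>k\<^sub>+\<^sub>1\<close>.\<close>

lemma antisymmetric_antisymmetrize:
  assumes u: "antisymmetric k u"
  shows "antisymmetric (Suc k) (antisymmetrize k u)"
  unfolding antisymmetric_def
proof (intro allI impI)
  fix \<sigma> assume \<sigma>: "\<sigma> permutes {1..Suc k}"
  let ?t = "\<lambda>i. swap i (Suc k)"
  let ?T = "\<lambda>i. frag_cmul (sign (?t i)) (push (permute (?t i)) u)"
  have T: "push (permute \<sigma>) (?T i) = frag_cmul (sign \<sigma>) (?T (\<sigma> i))" if i: "i \<in> {1..Suc k}" for i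
  proof -
    \<comment> \<open>The inner transposition sends \<open>k + 1\<close> to \<open>i\<close>, then
      \<sigma> sends it to \<open>\<sigma> i\<close>, and the outer one returns it to
      \<open>k + 1\<close>. So this product fixes \<open>k + 1\<close> and lies in the subgroup for
      which \<open>u\<close> is antisymmetric.\<close>
    let ?\<pi> = "?t (\<sigma> i) \<circ> (\<sigma> \<circ> ?t i)"
    have \<sigma>i: "\<sigma> i \<in> {1..Suc k}" using permutes_in_image[OF \<sigma>] i by simp
    have t: "?t i permutes {1..Suc k}" "?t (\<sigma> i) permutes {1..Suc k}"
      using i \<sigma>i by (intro permutes_swap_id; simp)+
    have \<pi>: "?\<pi> permutes {1..Suc k}"
      using t \<sigma> by (intro permutes_compose)
    have "?\<pi> x = x" if "x \<in> {1..Suc k} - {1..k}" for x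
    proof -
      have "x = Suc k" using that by auto
      then show ?thesis by simp
    qed
    then have \<pi>k: "?\<pi> permutes {1..k}"
      by (rule permutes_superset[OF \<pi>])
    have perm: "permutation \<sigma>" "permutation (?t i)" "permutation (?t (\<sigma> i))"
      by (rule permutes_imp_permutation[OF finite_atLeastAtMost], fact)+
    have bij: "bij \<sigma>" "bij (?t i)" "bij (?t (\<sigma> i))" "bij ?\<pi>"
      by (rule permutes_bij, fact)+
    have sign: "sign ?\<pi> = sign (?t (\<sigma> i)) * (sign \<sigma> * sign (?t i))"
      using perm by (simp add: sign_compose permutation_compose)
    have "\<sigma> \<circ> ?t i = ?t (\<sigma> i) \<circ> ?\<pi>"
      by (simp add: fun_eq_iff)
    then have "push (permute (\<sigma> \<circ> ?t i)) u = push (permute (?t (\<sigma> i))) (push (permute ?\<pi>) u)"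
      unfolding push_permute_compose[OF bij(3,4)] by (rule arg_cong[where f = "\<lambda>p. push (permute p) u"])
    also have "\<dots> = frag_cmul (sign ?\<pi>) (push (permute (?t (\<sigma> i))) u)"
      unfolding antisymmetricD[OF u \<pi>k] by (simp add: push_eq frag_map_cmul)
    finally have "push (permute \<sigma>) (?T i) =
        frag_cmul (sign (?t i) * sign ?\<pi>) (push (permute (?t (\<sigma> i))) u)"
      using push_permute_compose[OF bij(1,2), of u] by (simp add: push_eq frag_map_cmul)
    moreover have "sign (?t i) * sign ?\<pi> = sign \<sigma> * sign (?t (\<sigma> i))"
      unfolding sign using sign_idempotent[of "?t i"] by algebra
    ultimately show ?thesis by simp
  qed
  have "push (permute \<sigma>) (antisymmetrize k u) = (\<Sum>i=1..Suc k. push (permute \<sigma>) (?T i))"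
    unfolding antisymmetrize_def push_eq by (rule frag_map_sum) simp
  also have "\<dots> = (\<Sum>i=1..Suc k. frag_cmul (sign \<sigma>) (?T (\<sigma> i)))"
    using T by (rule sum.cong[OF refl])
  also have "\<dots> = frag_cmul (sign \<sigma>) (\<Sum>i=1..Suc k. ?T (\<sigma> i))"
    by (simp only: frag_cmul_sum)
  also have "(\<Sum>i=1..Suc k. ?T (\<sigma> i)) = (\<Sum>i=1..Suc k. ?T i)"
    by (rule sum.reindex_bij_betw[OF permutes_imp_bij[OF \<sigma>]])
  finally show "push (permute \<sigma>) (antisymmetrize k u) = frag_cmul (sign \<sigma>) (antisymmetrize k u)"
    unfolding antisymmetrize_def .
qed

lemma antisymmetrize_eq:
  "antisymmetrize k u = (\<Sum>i=1..k. frag_cmul (sign (swap i (Suc k)))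
     (push (permute (swap i (Suc k))) u)) + u"
  by (simp add: antisymmetrize_def permute_id)

text \<open>Forgetting the last two components is invariant under exchanging them.\<close>

lemma forget_forget_antisymmetric:
  fixes c :: "(nat \<Rightarrow> 'a) list \<Rightarrow>\<^sub>0 int"
  assumes c: "antisymmetric (Suc (Suc k)) c"
  shows "push (forget (Suc k)) (push (forget (Suc (Suc k))) c) = 0"
proof -
  let ?t = "swap (Suc k) (Suc (Suc k))"
  let ?p = "\<lambda>c. push (forget (Suc k)) (push (forget (Suc (Suc k))) c)"
  have "forget (Suc k) \<circ> forget (Suc (Suc k)) \<circ> permute ?t = (forget (Suc k) \<circ> forget (Suc (Suc k)) :: (nat \<Rightarrow> 'a) \<Rightarrow> _)"
    by (auto simp: fun_eq_iff forget_def permute_def Transposition.transpose_def)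
  then have "?p (push (permute ?t) c) = ?p c"
    by (simp add: push_eq frag_map_frag_map comp_assoc[symmetric])
  moreover have "?p (push (permute ?t) c) = - ?p c"
    using antisymmetric_transpose[OF c, of "Suc k" "Suc (Suc k)"]
    by (simp add: push_eq frag_map_uminus)
  ultimately show ?thesis using frag_eq_minus_self by metis
qed

text \<open>Permutations of the first k components fix the forgotten position, so they commute with
  forgetting it; extended by the identity they keep their sign.\<close>

lemma antisymmetric_forget:
  fixes c :: "(nat \<Rightarrow> 'a) list \<Rightarrow>\<^sub>0 int"
  assumes c: "antisymmetric (Suc k) c"
  shows "antisymmetric k (push (forget (Suc k)) c)"
  unfolding antisymmetric_def
proof (intro allI impI)
  fix \<sigma> assume \<sigma>: "\<sigma> permutes {1..k}"
  have inv: "inv_into UNIV \<sigma> l = l" if "l \<notin> {1..k}" for l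
    using permutes_inv[OF \<sigma>] that permutes_not_in by metis
  have "permute \<sigma> (forget (Suc k) x) l = forget (Suc k) (permute \<sigma> x) l" for x :: "nat \<Rightarrow> 'a" and l
  proof (cases "l \<in> {1..k}")
    case True
    then have "inv_into UNIV \<sigma> l \<in> {1..k}" using inv_permutes_mem[OF \<sigma>] by blast
    with True show ?thesis by (simp add: permute_def forget_def)
  next
    case False
    then show ?thesis using inv[of "Suc l"] inv[of l] by (auto simp: permute_def forget_def)
  qed
  then have "permute \<sigma> \<circ> forget (Suc k) = (forget (Suc k) \<circ> permute \<sigma> :: (nat \<Rightarrow> 'a) \<Rightarrow> _)"
    by (simp add: fun_eq_iff)
  then have "push (permute \<sigma>) (push (forget (Suc k)) c) = push (forget (Suc k)) (push (permute \<sigma>) c)"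
    by (simp add: push_eq frag_map_frag_map)
  moreover have "\<sigma> permutes {1..Suc k}"
    using \<sigma> by (rule permutes_subset) simp
  ultimately show "push (permute \<sigma>) (push (forget (Suc k)) c) =
      frag_cmul (sign \<sigma>) (push (forget (Suc k)) c)"
    using antisymmetricD[OF c] by (simp add: push_eq frag_map_cmul)
qed

section \<open>Exactness\<close>

lemma carrier_simplicial_chains: "c \<in> carrier (simplicial_chains n T) \<longleftrightarrow>
    Poly_Mapping.keys c \<subseteq> ordered_simplices n T"
  by (simp add: simplicial_chains_def)

lemma mult_simplicial_chains [simp]: "x \<otimes>\<^bsub>simplicial_chains n T\<^esub> y = x + y"
  and one_simplicial_chains [simp]: "\<one>\<^bsub>simplicial_chains n T\<^esub> = 0"
  by (simp_all add: simplicial_chains_def)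

lemma mult_alternating_chains [simp]: "x \<otimes>\<^bsub>alternating_chains n k T\<^esub> y = x + y"
  and one_alternating_chains [simp]: "\<one>\<^bsub>alternating_chains n k T\<^esub> = 0"
  by (simp_all add: alternating_chains_eq)

section \<open>Faces, permutations and lifts on fibre powers\<close>

context finite_to_one_simplicial_map
begin

lemma fibre_power_iff:
  "g \<in> fibre_power n k \<longleftrightarrow>
     (\<forall>l. l \<notin> {1..k} \<longrightarrow> column l g = replicate (length g) 0) \<and>
     (\<forall>l\<in>{1..k}. column l g \<in> ordered_simplices n K \<and> map f (column l g) = map f (column 1 g))"
proof -
  have "set g \<subseteq> tuples k UNIV \<longleftrightarrow> (\<forall>l. l \<notin> {1..k} \<longrightarrow> column l g = replicate (length g) 0)"
    unfolding tuples_def column_def by (force simp: list_eq_iff_nth_eq in_set_conv_nth)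
  then show ?thesis unfolding fibre_power_def by simp
qed

lemma fibre_power_zero:
  "g \<in> fibre_power n k \<Longrightarrow> l \<notin> {1..k} \<Longrightarrow> column l g = replicate (length g) 0"
  unfolding fibre_power_iff by blast

lemma fibre_powerI:
  assumes "\<And>l. l \<notin> {1..k} \<Longrightarrow> column l g = replicate (length g) 0"
    and "\<And>l. l \<in> {1..k} \<Longrightarrow> column l g \<in> ordered_simplices n K"
    and "\<And>l. l \<in> {1..k} \<Longrightarrow> map f (column l g) = t"
  shows "g \<in> fibre_power n k"
proof -
  have "map f (column l g) = map f (column 1 g)" if "l \<in> {1..k}" for l
    using that assms(3)[of l] assms(3)[of 1] by simp
  with assms(1,2) show ?thesis unfolding fibre_power_iff by blast
qed

lemma length_fibre_power:
  assumes "g \<in> fibre_power n k" "1 \<le> k"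
  shows "length g = n + 1"
  using fibre_power_column(1)[OF assms(1), of 1] assms(2) by (simp add: ordered_simplices_def)

lemma forget_fibre_power:
  assumes g: "g \<in> fibre_power n k" and i: "i \<in> {1..k}"
  shows "map (forget i) g \<in> fibre_power n (k - 1)"
proof (rule fibre_powerI)
  fix l assume l: "l \<in> {1..k-1}"
  then have "l \<in> {1..k}" "Suc l \<in> {1..k}" by auto
  then show "column l (map (forget i) g) \<in> ordered_simplices n K"
    "map f (column l (map (forget i) g)) = map f (column 1 g)"
    using fibre_power_column[OF g, of l] fibre_power_column[OF g, of "Suc l"]
    by (simp_all add: column_forget del: One_nat_def)
next
  fix l assume "l \<notin> {1..k-1}"
  then have "if l < i then l \<notin> {1..k} else Suc l \<notin> {1..k}" using i by auto
  then show "column l (map (forget i) g) = replicate (length (map (forget i) g)) 0"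
    using fibre_power_zero[OF g, of l] fibre_power_zero[OF g, of "Suc l"]
    by (simp add: column_forget split: if_splits)
qed

lemma permute_fibre_power:
  assumes g: "g \<in> fibre_power n k" and \<sigma>: "\<sigma> permutes {1..k}"
  shows "map (permute \<sigma>) g \<in> fibre_power n k"
proof (rule fibre_powerI)
  fix l
  let ?l = "inv_into UNIV \<sigma> l"
  note mem = inv_permutes_mem[OF \<sigma>, of l]
  show "column l (map (permute \<sigma>) g) = replicate (length (map (permute \<sigma>) g)) 0" if "l \<notin> {1..k}"
    using fibre_power_zero[OF g, of ?l] that mem by (simp only: column_permute length_map) simp
  show "column l (map (permute \<sigma>) g) \<in> ordered_simplices n K"
    "map f (column l (map (permute \<sigma>) g)) = map f (column 1 g)" if "l \<in> {1..k}"
    using fibre_power_column[OF g, of ?l] that mem by (simp_all only: column_permute simp_thms)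
qed

text \<open>The choice is made once for each ordered simplex of Y, hence shared by all matrices over
  it, whatever their columns.\<close>

definition lift :: "nat \<Rightarrow> 'b list \<Rightarrow> 'a list" where
  "lift n t = (SOME s. s \<in> ordered_simplices n K \<and> map f s = t)"

lemma lift:
  assumes "t \<in> ordered_simplices n L"
  shows "lift n t \<in> ordered_simplices n K" "map f (lift n t) = t"
  using someI_ex[of "\<lambda>s. s \<in> ordered_simplices n K \<and> map f s = t"] ordered_simplex_lift[OF assms]
  unfolding lift_def by blast+

definition append_lift :: "nat \<Rightarrow> nat \<Rightarrow> (nat \<Rightarrow> 'a) list \<Rightarrow> (nat \<Rightarrow> 'a) list" where
  "append_lift n k g = append_column k g (lift n (map f (column 1 g)))"

lemma lift_fibre:
  assumes "g \<in> fibre_power n k" "1 \<le> k"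
  shows "lift n (map f (column 1 g)) \<in> ordered_simplices n K"
    "map f (lift n (map f (column 1 g))) = map f (column 1 g)"
  using lift[OF map_ordered_simplex] fibre_power_column(1)[OF assms(1), of 1] assms(2) by auto

lemma length_lift:
  assumes "g \<in> fibre_power n k" "1 \<le> k"
  shows "length (lift n (map f (column 1 g))) = length g"
  using lift_fibre(1)[OF assms] length_fibre_power[OF assms] by (simp add: ordered_simplices_def)

lemma column_append_lift:
  assumes "g \<in> fibre_power n k" "1 \<le> k"
  shows "column l (append_lift n k g) =
    (if l = Suc k then lift n (map f (column 1 g)) else column l g)"
  unfolding append_lift_def by (rule column_append[OF length_lift[OF assms]])

lemma append_lift_fibre_power:
  assumes g: "g \<in> fibre_power n k" and k: "1 \<le> k"
  shows "append_lift n k g \<in> fibre_power n (Suc k)"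
proof (rule fibre_powerI)
  fix l assume "l \<in> {1..Suc k}"
  then have "l = Suc k \<or> l \<noteq> Suc k \<and> l \<in> {1..k}" by auto
  then show "column l (append_lift n k g) \<in> ordered_simplices n K"
    "map f (column l (append_lift n k g)) = map f (column 1 g)"
    using lift_fibre[OF g k] fibre_power_column[OF g] by (auto simp: column_append_lift[OF g k])
next
  fix l assume "l \<notin> {1..Suc k}"
  then have "l \<noteq> Suc k" "l \<notin> {1..k}" by auto
  moreover have "length (append_lift n k g) = length g"
    unfolding append_lift_def by (rule length_append_column[OF length_lift[OF g k]])
  ultimately show "column l (append_lift n k g) = replicate (length (append_lift n k g)) 0"
    using fibre_power_zero[OF g] by (simp add: column_append_lift[OF g k])
qed

lemma forget_last_append_lift:
  assumes g: "g \<in> fibre_power n k" and k: "1 \<le> k"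
  shows "map (forget (Suc k)) (append_lift n k g) = g"
proof (rule column_ext)
  fix l
  \<comment> \<open>Beyond position \<open>k\<close> the shift compares two columns of
    zeros.\<close>
  show "column l (map (forget (Suc k)) (append_lift n k g)) = column l g"
    using fibre_power_zero[OF g, of l] fibre_power_zero[OF g, of "Suc l"]
    by (auto simp: column_forget column_append_lift[OF g k])
qed

text \<open>Reading the common image from another column yields the same lift; this is why appending
  commutes with faces and permutations.\<close>

lemma map_f_column_1:
  assumes g: "g \<in> fibre_power n k" and l: "l \<in> {1..k}" and h: "column 1 h = column l g"
  shows "lift n (map f (column 1 h)) = lift n (map f (column 1 g))"
  using fibre_power_column(2)[OF g l] h by simp

lemma forget_append_lift:
  assumes g: "g \<in> fibre_power n k" and k: "2 \<le> k" and i: "i \<in> {1..k}"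
  shows "map (forget i) (append_lift n k g) = append_lift n (k - 1) (map (forget i) g)"
proof (rule column_ext)
  fix l
  have k1: "1 \<le> k" "1 \<le> k - 1" using k by auto
  \<comment> \<open>The index in \<open>g\<close> of the column that comes first after forgetting
    \<open>i\<close>; for \<open>i = 1\<close> it is the second, which exists since
    \<open>2 \<le> k\<close>.\<close>
  let ?m = "if 1 < i then 1 else 2 :: nat"
  have "column 1 (map (forget i) g) = column ?m g"
    by (simp add: column_forget numeral_2_eq_2)
  then have "lift n (map f (column 1 (map (forget i) g))) = lift n (map f (column 1 g))"
    using k by (intro map_f_column_1[OF g]) auto
  then show "column l (map (forget i) (append_lift n k g)) =
      column l (append_lift n (k - 1) (map (forget i) g))"
    using i k by (auto simp: column_append_lift[OF forget_fibre_power[OF g i] k1(2)] column_forget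
        column_append_lift[OF g k1(1)] simp del: One_nat_def)
qed

lemma permute_append_lift:
  assumes g: "g \<in> fibre_power n k" and k: "1 \<le> k" and \<sigma>: "\<sigma> permutes {1..k}"
  shows "map (permute \<sigma>) (append_lift n k g) = append_lift n k (map (permute \<sigma>) g)"
proof (rule column_ext)
  fix l
  have inv: "inv_into UNIV \<sigma> l = Suc k \<longleftrightarrow> l = Suc k"
    using \<sigma> permutes_inv[OF \<sigma>] permutes_not_in[of _ "{1..k}" "Suc k"] permutes_inv_eq[OF \<sigma>]
    by (metis Suc_n_not_le_n atLeastAtMost_iff)
  have "inv_into UNIV \<sigma> 1 \<in> {1..k}" using inv_permutes_mem[OF \<sigma>] k by simp
  then have "lift n (map f (column 1 (map (permute \<sigma>) g))) = lift n (map f (column 1 g))"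
    by (intro map_f_column_1[OF g]) (simp_all add: column_permute)
  then show "column l (map (permute \<sigma>) (append_lift n k g)) =
      column l (append_lift n k (map (permute \<sigma>) g))"
    using inv by (simp only: column_append_lift[OF permute_fibre_power[OF g \<sigma>] k] column_permute
        column_append_lift[OF g k])
qed

text \<open>Both sides replace the \<open>i\<close>-th column of \<open>g\<close> by the lifted simplex.\<close>

lemma forget_swap_append_lift:
  assumes g: "g \<in> fibre_power n k" and k: "2 \<le> k" and i: "i \<in> {1..k}"
  shows "map (forget (Suc k)) (map (permute (swap i (Suc k))) (append_lift n k g)) =
    map (permute (swap i k)) (append_lift n (k - 1) (map (forget k) (map (permute (swap i k)) g)))"
proof (rule column_ext)
  fix l
  have k1: "1 \<le> k" "1 \<le> k - 1" "k \<in> {1..k}" using k by auto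
  have inv: "inv_into UNIV (swap a b) = swap a b" for a b
    by (rule inv_unique_comp) simp_all
  \<comment> \<open>Column \<open>i\<close> moves to the last place, where \<open>forget k\<close>
    deletes it, while column \<open>k\<close> waits at position \<open>i\<close>; the outer
    transposition puts it back.\<close>
  let ?g = "map (permute (swap i k)) g"
  have \<sigma>: "swap i k permutes {1..k}" using i k1 by (intro permutes_swap_id)
  note g' = permute_fibre_power[OF g \<sigma>]
  have zero: "column l g = column (Suc l) g" if "l > k"
    using fibre_power_zero[OF g, of l] fibre_power_zero[OF g, of "Suc l"] that by simp
  show "column l (map (forget (Suc k)) (map (permute (swap i (Suc k))) (append_lift n k g))) =
      column l (map (permute (swap i k)) (append_lift n (k - 1) (map (forget k) ?g)))"
    using i k zero
    by (auto simp: column_permute column_forget inv fibre_power_column(2)[OF g k1(3)]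
        column_append_lift[OF g k1(1)]
        column_append_lift[OF forget_fibre_power[OF g' k1(3)] k1(2)] Transposition.transpose_def
        simp del: map_map One_nat_def)
qed

text \<open>Over each ordered simplex of Y this is coning with the chosen lift as apex, placed
  last.\<close>

definition cone :: "nat \<Rightarrow> nat \<Rightarrow> ((nat \<Rightarrow> 'a) list \<Rightarrow>\<^sub>0 int) \<Rightarrow> ((nat \<Rightarrow> 'a) list \<Rightarrow>\<^sub>0 int)" where
  "cone n k = frag_map (append_lift n k)"

lemma keys_cone:
  assumes "Poly_Mapping.keys c \<subseteq> fibre_power n k" "1 \<le> k"
  shows "Poly_Mapping.keys (cone n k c) \<subseteq> fibre_power n (Suc k)"
  unfolding cone_def by (rule keys_frag_map[OF assms(1)]) (rule append_lift_fibre_power[OF _ assms(2)])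

lemma keys_push_forget:
  assumes "Poly_Mapping.keys c \<subseteq> fibre_power n k" "i \<in> {1..k}"
  shows "Poly_Mapping.keys (push (forget i) c) \<subseteq> fibre_power n (k - 1)"
  unfolding push_eq by (rule keys_frag_map[OF assms(1)]) (rule forget_fibre_power[OF _ assms(2)])

lemma keys_push_permute:
  assumes "Poly_Mapping.keys c \<subseteq> fibre_power n k" "\<sigma> permutes {1..k}"
  shows "Poly_Mapping.keys (push (permute \<sigma>) c) \<subseteq> fibre_power n k"
  unfolding push_eq by (rule keys_frag_map[OF assms(1)]) (rule permute_fibre_power[OF _ assms(2)])

lemma keys_rho:
  assumes "Poly_Mapping.keys c \<subseteq> fibre_power n k"
  shows "Poly_Mapping.keys (rho k c) \<subseteq> fibre_power n (k - 1)"
  unfolding rho_def using keys_push_forget[OF assms] by (intro keys_frag_sum)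

lemma keys_antisymmetrize:
  assumes "Poly_Mapping.keys c \<subseteq> fibre_power n (Suc k)"
  shows "Poly_Mapping.keys (antisymmetrize k c) \<subseteq> fibre_power n (Suc k)"
  unfolding antisymmetrize_def
  by (intro keys_frag_sum keys_push_permute[OF assms] permutes_swap_id) auto

lemma push_forget_last_cone:
  assumes c: "Poly_Mapping.keys c \<subseteq> fibre_power n k" and k: "1 \<le> k"
  shows "push (forget (Suc k)) (cone n k c) = c"
  unfolding cone_def push_eq frag_map_frag_map
  using c forget_last_append_lift[OF _ k] by (intro frag_map_ident) auto

lemma push_forget_cone:
  assumes c: "Poly_Mapping.keys c \<subseteq> fibre_power n k" and k: "2 \<le> k" "i \<in> {1..k}"
  shows "push (forget i) (cone n k c) = cone n (k - 1) (push (forget i) c)"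
  unfolding cone_def push_eq frag_map_frag_map
  using c forget_append_lift[OF _ k] by (intro frag_map_cong) auto

text \<open>The first k faces commute with the cone and the last one undoes it; so the cone
  contracts the complex up to the sign \<open>(-1) ^ k\<close> of the last face.\<close>

lemma rho_cone:
  assumes c: "Poly_Mapping.keys c \<subseteq> fibre_power n k" and k: "2 \<le> k"
  shows "rho (Suc k) (cone n k c) = cone n (k - 1) (rho k c) + frag_cmul ((-1) ^ k) c"
proof -
  have "rho (Suc k) (cone n k c) =
      (\<Sum>i=1..k. frag_cmul ((-1) ^ (i - 1)) (push (forget i) (cone n k c))) +
      frag_cmul ((-1) ^ k) (push (forget (Suc k)) (cone n k c))"
    by (simp add: rho_def)
  also have "push (forget (Suc k)) (cone n k c) = c"
    using push_forget_last_cone[OF c] k by simp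
  also have "(\<Sum>i=1..k. frag_cmul ((-1) ^ (i - 1)) (push (forget i) (cone n k c))) =
      (\<Sum>i=1..k. frag_cmul ((-1) ^ (i - 1)) (cone n (k - 1) (push (forget i) c)))"
    using push_forget_cone[OF c k] by (intro sum.cong) auto
  also have "\<dots> = cone n (k - 1) (rho k c)"
    unfolding rho_def cone_def by (simp add: frag_map_sum frag_map_cmul)
  finally show ?thesis .
qed

lemma rho_exact:
  assumes z: "Poly_Mapping.keys z \<subseteq> fibre_power n k" and k: "2 \<le> k" and rho: "rho k z = 0"
  shows "\<exists>w. Poly_Mapping.keys w \<subseteq> fibre_power n (Suc k) \<and> rho (Suc k) w = z"
proof (intro exI conjI)
  \<comment> \<open>Scaling by the sign of the last face makes its contribution exactly
    \<open>z\<close>.\<close>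
  let ?z = "frag_cmul ((-1) ^ k) z"
  have z': "Poly_Mapping.keys ?z \<subseteq> fibre_power n k"
    using z keys_cmul by blast
  show "Poly_Mapping.keys (cone n k ?z) \<subseteq> fibre_power n (Suc k)"
    using keys_cone[OF z'] k by simp
  have "rho k ?z = frag_cmul ((-1) ^ k) (rho k z)"
    by (simp add: rho_def push_eq frag_map_cmul frag_cmul_sum mult.commute)
  then show "rho (Suc k) (cone n k ?z) = z"
    using rho_cone[OF z' k] rho by (simp add: cone_def flip: power_mult_distrib)
qed

text \<open>The appended lift is the same for all orderings of the old columns, so antisymmetry in
  these passes to the cone; the new column is brought in only by
  \<open>antisymmetrize\<close>.\<close>

lemma antisymmetric_cone:
  assumes c: "Poly_Mapping.keys c \<subseteq> fibre_power n k" and k: "1 \<le> k" and a: "antisymmetric k c"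
  shows "antisymmetric k (cone n k c)"
  unfolding antisymmetric_def
proof (intro allI impI)
  fix \<sigma> assume \<sigma>: "\<sigma> permutes {1..k}"
  have "push (permute \<sigma>) (cone n k c) = cone n k (push (permute \<sigma>) c)"
    unfolding cone_def push_eq frag_map_frag_map
    using c permute_append_lift[OF _ k \<sigma>] by (intro frag_map_cong) auto
  then show "push (permute \<sigma>) (cone n k c) = frag_cmul (sign \<sigma>) (cone n k c)"
    using antisymmetricD[OF a \<sigma>] by (simp add: cone_def frag_map_cmul)
qed

lemma push_forget_swap_cone:
  assumes c: "Poly_Mapping.keys c \<subseteq> fibre_power n k" and k: "2 \<le> k" and i: "i \<in> {1..k}"
  shows "push (forget (Suc k)) (push (permute (swap i (Suc k))) (cone n k c)) =
    push (permute (swap i k)) (cone n (k - 1) (push (forget k) (push (permute (swap i k)) c)))"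
  unfolding cone_def push_eq frag_map_frag_map
  using c forget_swap_append_lift[OF _ k i] by (intro frag_map_cong) auto

text \<open>The cone over \<open>z\<close> need not be alternating, but its antisymmetrization is; the added terms are
  mapped to zero because they factor through \<open>push (forget k) z\<close>.\<close>

lemma alternating_exact:
  assumes z: "Poly_Mapping.keys z \<subseteq> fibre_power n k" and a: "antisymmetric k z" and k: "2 \<le> k"
    and 0: "push (forget k) z = 0"
  shows "\<exists>w. Poly_Mapping.keys w \<subseteq> fibre_power n (Suc k) \<and> antisymmetric (Suc k) w \<and>
    push (forget (Suc k)) w = z"
proof (intro exI conjI)
  have k1: "1 \<le> k" "k \<in> {1..k}" using k by auto
  let ?w = "antisymmetrize k (cone n k z)"
  show "Poly_Mapping.keys ?w \<subseteq> fibre_power n (Suc k)"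
    by (intro keys_antisymmetrize keys_cone z k1)
  show "antisymmetric (Suc k) ?w"
    by (intro antisymmetric_antisymmetrize antisymmetric_cone z k1 a)
  have "push (forget (Suc k)) (frag_cmul b (push (permute (swap i (Suc k))) (cone n k z))) = 0"
    if i: "i \<in> {1..k}" for i b
  proof -
    \<comment> \<open>A permutation inside \<open>{1..k}\<close> changes \<open>z\<close> at most by
      a sign, so the vanishing of the last face persists.\<close>
    have "push (permute (swap i k)) z = frag_cmul (sign (swap i k)) z"
      using antisymmetricD[OF a permutes_swap_id[OF i k1(2)]] .
    then have "push (forget k) (push (permute (swap i k)) z) = 0"
      using 0 by (simp add: push_eq frag_map_cmul)
    then show ?thesis
      using push_forget_swap_cone[OF z k i] by (simp add: push_eq frag_map_cmul cone_def)
  qed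
  then have "push (forget (Suc k)) ?w = push (forget (Suc k)) (cone n k z)"
    unfolding antisymmetrize_eq push_eq by (simp add: frag_map_add frag_map_sum)
  then show "push (forget (Suc k)) ?w = z"
    using push_forget_last_cone[OF z k1(1)] by simp
qed

section \<open>The end of the sequences, where 1-tuples become points of X\<close>

lemma tuple1_fibre_power:
  assumes "s \<in> ordered_simplices n K"
  shows "map tuple1 s \<in> fibre_power n 1"
  using assms by (intro fibre_powerI[where t = "map f s"]) (auto simp: column_tuple1)

lemma map_tuple1_untuple:
  assumes g: "g \<in> fibre_power n 1"
  shows "map tuple1 (map untuple g) = g"
proof (rule column_ext)
  fix l
  show "column l (map tuple1 (map untuple g)) = column l g"
    using fibre_power_zero[OF g, of l] by (simp add: map_untuple column_tuple1)
qed

text \<open>\<open>tuple1\<close> inverts \<open>untuple\<close> on these matrices. Cycles for the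
  map into C_n(X) are thus cycles for the map into chains of 1-tuples, where the general argument
  applies.\<close>

lemma push_untuple_eq_0:
  assumes c: "Poly_Mapping.keys c \<subseteq> fibre_power n 1" and 0: "push untuple c = 0"
  shows "c = 0"
proof -
  have "push tuple1 (push untuple c) = c"
    unfolding push_eq frag_map_frag_map
    using c map_tuple1_untuple by (intro frag_map_ident) auto
  then show ?thesis using 0 by (simp add: push_eq)
qed

lemma keys_push_untuple:
  assumes "Poly_Mapping.keys c \<subseteq> fibre_power n 1"
  shows "Poly_Mapping.keys (push untuple c) \<subseteq> ordered_simplices n K"
  unfolding push_eq using fibre_power_column(1)
  by (intro keys_frag_map[OF assms]) (simp add: map_untuple del: One_nat_def)

lemma keys_push_f:
  assumes "Poly_Mapping.keys c \<subseteq> ordered_simplices n K"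
  shows "Poly_Mapping.keys (push f c) \<subseteq> ordered_simplices n L"
  unfolding push_eq by (rule keys_frag_map[OF assms map_ordered_simplex])

text \<open>The two columns have the same image, so it does not matter which one is kept.\<close>

lemma push_f_forget:
  assumes c: "Poly_Mapping.keys c \<subseteq> fibre_power n 2" and i: "i \<in> {1..2}"
  shows "push f (push untuple (push (forget i) c)) = push f (push untuple c)"
proof -
  have "map f (map untuple (map (forget i) g)) = map f (map untuple g)" if g: "g \<in> fibre_power n 2" for g
    using fibre_power_column(2)[OF g, of 2]
    by (simp add: map_untuple column_forget del: map_map One_nat_def)
  then show ?thesis
    unfolding push_eq frag_map_frag_map using c by (intro frag_map_cong) auto
qed

text \<open>The cone turns \<open>s\<close> into the pair of \<open>s\<close> and the lift of
  \<open>map f s\<close>. The projections that return the lift factor through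
  \<open>push f z\<close>, which vanishes when \<open>z\<close> is a cycle.\<close>

lemma cone_tuple1:
  assumes z: "Poly_Mapping.keys z \<subseteq> ordered_simplices n K"
  defines "u \<equiv> cone n 1 (push tuple1 z)"
  shows "Poly_Mapping.keys u \<subseteq> fibre_power n 2"
    "push untuple (push (forget 1) u) = frag_map (lift n) (push f z)"
    "push untuple (push (forget 2) u) = z"
    "push untuple (push (forget 2) (push (permute (swap 1 2)) u)) = frag_map (lift n) (push f z)"
proof -
  have "Poly_Mapping.keys (push tuple1 z) \<subseteq> fibre_power n 1"
    unfolding push_eq by (rule keys_frag_map[OF z tuple1_fibre_power])
  from keys_cone[OF this] show "Poly_Mapping.keys u \<subseteq> fibre_power n 2"
    by (simp add: u_def numeral_2_eq_2)
  have col: "column l (append_lift n 1 (map tuple1 s)) =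
      (if l = 2 then lift n (map f s) else column l (map tuple1 s))"
    if "s \<in> ordered_simplices n K" for s l
    using column_append_lift[OF tuple1_fibre_power[OF that], of l]
    by (simp add: column_tuple1 numeral_2_eq_2)
  have inv: "inv_into UNIV (swap 1 2) = swap 1 2"
    by (rule inv_unique_comp) simp_all
  show "push untuple (push (forget 1) u) = frag_map (lift n) (push f z)"
    unfolding u_def cone_def push_eq frag_map_frag_map using z
    by (intro frag_map_cong)
      (auto simp: map_untuple column_forget col simp del: map_map One_nat_def)
  show "push untuple (push (forget 2) u) = z"
    unfolding u_def cone_def push_eq frag_map_frag_map using z
    by (intro frag_map_ident)
      (auto simp: map_untuple column_forget col column_tuple1 simp del: map_map One_nat_def)
  show "push untuple (push (forget 2) (push (permute (swap 1 2)) u)) = frag_map (lift n) (push f z)"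
    unfolding u_def cone_def push_eq frag_map_frag_map using z
    by (intro frag_map_cong)
      (auto simp: map_untuple column_forget column_permute inv col simp del: map_map One_nat_def)
qed

lemma rho_exact_base:
  assumes z: "Poly_Mapping.keys z \<subseteq> ordered_simplices n K" and 0: "push f z = 0"
  shows "\<exists>w. Poly_Mapping.keys w \<subseteq> fibre_power n 2 \<and> push untuple (rho 2 w) = z"
proof (intro exI conjI)
  let ?u = "cone n 1 (push tuple1 z)"
  note u = cone_tuple1[OF z]
  \<comment> \<open>\<open>rho 2\<close> is the first face minus the second, and it is the second
    that returns \<open>z\<close>; hence the minus sign.\<close>
  show "Poly_Mapping.keys (- ?u) \<subseteq> fibre_power n 2"
    using u(1) by simp
  have "push untuple (rho 2 (- ?u)) =
      push untuple (push (forget 2) ?u) - push untuple (push (forget 1) ?u)"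
    by (simp add: rho_2 push_eq frag_map_diff frag_map_uminus)
  then show "push untuple (rho 2 (- ?u)) = z"
    using u(2,3) 0 by simp
qed

lemma alternating_exact_base:
  assumes z: "Poly_Mapping.keys z \<subseteq> ordered_simplices n K" and 0: "push f z = 0"
  shows "\<exists>w. Poly_Mapping.keys w \<subseteq> fibre_power n 2 \<and> antisymmetric 2 w \<and>
    push untuple (push (forget 2) w) = z"
proof (intro exI conjI)
  let ?u = "cone n 1 (push tuple1 z)"
  let ?w = "antisymmetrize 1 ?u"
  note u = cone_tuple1[OF z]
  have 2: "Suc 1 = (2 :: nat)" by simp
  have "antisymmetric 1 ?u"
    by (simp add: antisymmetric_def permute_id)
  then show "antisymmetric 2 ?w"
    using antisymmetric_antisymmetrize 2 by metis
  show "Poly_Mapping.keys ?w \<subseteq> fibre_power n 2"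
    using keys_antisymmetrize[of ?u n 1] u(1) by (simp only: 2)
  \<comment> \<open>For \<open>k = 1\<close> there are two terms, and the projection of the swapped
    one vanishes because \<open>push f z = 0\<close>.\<close>
  have "?w = ?u - push (permute (swap 1 2)) ?u"
    unfolding antisymmetrize_eq 2 by (simp add: sign_swap_id)
  then show "push untuple (push (forget 2) ?w) = z"
    using u(3,4) 0 by (simp add: push_eq frag_map_diff)
qed

section \<open>The exact sequences on W^k and D^k\<close>

lemma carrier_W_chains:
  assumes "1 \<le> k"
  shows "c \<in> carrier (simplicial_chains n (W_complex K L f k)) \<longleftrightarrow>
    Poly_Mapping.keys c \<subseteq> fibre_power n k"
  by (simp add: simplicial_chains_def ordered_simplices_W[OF assms])

text \<open>Antisymmetry leaves only matrices with distinct columns in the support, and these belong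
  to D^k; so the alternating sequence can be computed in the fibre powers.\<close>

lemma carrier_alternating_D_chains:
  assumes k: "1 \<le> k"
  shows "c \<in> carrier (alternating_chains n k (D_complex K L f k)) \<longleftrightarrow>
    Poly_Mapping.keys c \<subseteq> fibre_power n k \<and> antisymmetric k c"
proof -
  have "Poly_Mapping.keys c \<subseteq> ordered_simplices n (D_complex K L f k)"
    if "Poly_Mapping.keys c \<subseteq> fibre_power n k" "antisymmetric k c"
    using that ordered_simplices_D_injective[OF k] antisymmetric_keys_injective by blast
  then show ?thesis
    using ordered_simplices_D_subset[OF k] unfolding alternating_chains_eq
    by (auto simp: carrier_simplicial_chains)
qed

lemma group_hom_push_f: "group_hom (simplicial_chains n K) (simplicial_chains n L) (push f)"
  by (intro group_hom.intro group_hom_axioms.intro group_simplicial_chains homI)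
    (auto simp: carrier_simplicial_chains push_eq frag_map_add keys_push_f[unfolded push_eq])

lemma keys_rho_2:
  assumes "Poly_Mapping.keys c \<subseteq> fibre_power n 2"
  shows "Poly_Mapping.keys (rho 2 c) \<subseteq> fibre_power n 1"
  using keys_rho[OF assms] by simp

lemma exact_W:
  assumes k: "3 \<le> k"
  shows "exact_at
    (simplicial_chains n (W_complex K L f (k + 1))) (rho (k + 1))
    (simplicial_chains n (W_complex K L f k)) (rho k)
    (simplicial_chains n (W_complex K L f (k - 1)))"
proof (rule exact_atI)
  have hom: "group_hom (simplicial_chains n (W_complex K L f m)) (simplicial_chains n (W_complex K L f (m - 1)))
      (rho m)" if m: "2 \<le> m" for m
    using m keys_rho[of _ n m]
    by (intro group_hom.intro group_hom_axioms.intro group_simplicial_chains homI)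
      (simp_all add: carrier_W_chains rho_add)
  show "group_hom (simplicial_chains n (W_complex K L f (k + 1))) (simplicial_chains n (W_complex K L f k))
      (rho (k + 1))"
    using hom[of "k + 1"] k by simp
  show "group_hom (simplicial_chains n (W_complex K L f k)) (simplicial_chains n (W_complex K L f (k - 1)))
      (rho k)"
    using hom[of k] k by simp
qed (use k rho_exact[of _ n k] in \<open>auto simp: carrier_W_chains rho_rho Bex_def\<close>)

lemma group_hom_W_2:
  "group_hom (simplicial_chains n (W_complex K L f 2)) (simplicial_chains n K) (push untuple \<circ> rho 2)"
  using keys_push_untuple[OF keys_rho_2]
  by (intro group_hom.intro group_hom_axioms.intro group_simplicial_chains homI)
    (simp_all add: carrier_W_chains carrier_simplicial_chains[of _ n K] rho_add push_eq frag_map_add)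

text \<open>Injectivity of \<open>push untuple\<close> on chains of 1-tuples reduces this to the
  case \<open>k = 2\<close> of \<open>rho_exact\<close>.\<close>

lemma exact_W_2:
  "exact_at
    (simplicial_chains n (W_complex K L f 3)) (rho 3)
    (simplicial_chains n (W_complex K L f 2)) (push untuple \<circ> rho 2)
    (simplicial_chains n K)"
proof (rule exact_atI[OF _ group_hom_W_2])
  show "group_hom (simplicial_chains n (W_complex K L f 3)) (simplicial_chains n (W_complex K L f 2)) (rho 3)"
    using keys_rho[of _ n 3]
    by (intro group_hom.intro group_hom_axioms.intro group_simplicial_chains homI)
      (simp_all add: carrier_W_chains rho_add)
  show "(push untuple \<circ> rho 2) (rho 3 c) = \<one>\<^bsub>simplicial_chains n K\<^esub>" for c
    using rho_rho[of 2 c] by (simp add: push_eq)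
  fix z assume z: "z \<in> carrier (simplicial_chains n (W_complex K L f 2))"
    "(push untuple \<circ> rho 2) z = \<one>\<^bsub>simplicial_chains n K\<^esub>"
  then have keys: "Poly_Mapping.keys z \<subseteq> fibre_power n 2" by (simp add: carrier_W_chains)
  then have "rho 2 z = 0"
    using push_untuple_eq_0[OF keys_rho_2] z(2) by simp
  then show "\<exists>w\<in>carrier (simplicial_chains n (W_complex K L f 3)). rho 3 w = z"
    using rho_exact[OF keys order_refl] by (auto simp: carrier_W_chains Bex_def)
qed

lemma exact_W_1:
  "exact_at
    (simplicial_chains n (W_complex K L f 2)) (push untuple \<circ> rho 2)
    (simplicial_chains n K) (push f)
    (simplicial_chains n L)"
proof (rule exact_atI[OF group_hom_W_2 group_hom_push_f])
  fix c assume "c \<in> carrier (simplicial_chains n (W_complex K L f 2))"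
  then have c: "Poly_Mapping.keys c \<subseteq> fibre_power n 2" by (simp add: carrier_W_chains)
  have "push f (push untuple (rho 2 c)) =
      push f (push untuple (push (forget 1) c)) - push f (push untuple (push (forget 2) c))"
    unfolding rho_2 push_eq by (simp add: frag_map_diff)
  also have "\<dots> = 0"
    using push_f_forget[OF c, of 1] push_f_forget[OF c, of 2] by simp
  finally show "push f ((push untuple \<circ> rho 2) c) = \<one>\<^bsub>simplicial_chains n L\<^esub>" by simp
qed (use rho_exact_base[of _ n] in \<open>auto simp: carrier_W_chains carrier_simplicial_chains[of _ n K] Bex_def\<close>)

text \<open>Lifting each ordered simplex gives a section of \<open>push f\<close> on chains.\<close>

lemma push_f_epi: "push f \<in> epi (simplicial_chains n K) (simplicial_chains n L)"
proof -
  have "d \<in> push f ` carrier (simplicial_chains n K)" if "d \<in> carrier (simplicial_chains n L)" for d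
  proof
    have d: "Poly_Mapping.keys d \<subseteq> ordered_simplices n L"
      using that by (simp add: carrier_simplicial_chains)
    show "d = push f (frag_map (lift n) d)"
      unfolding push_eq frag_map_frag_map using d lift(2)
      by (intro frag_map_ident[symmetric]) auto
    show "frag_map (lift n) d \<in> carrier (simplicial_chains n K)"
      unfolding carrier_simplicial_chains by (rule keys_frag_map[OF d lift(1)])
  qed
  moreover have hom: "push f \<in> hom (simplicial_chains n K) (simplicial_chains n L)"
    using group_hom_push_f unfolding group_hom_def group_hom_axioms_def by blast
  ultimately show ?thesis
    using hom_carrier[OF hom] unfolding epi_def by blast
qed

lemma group_hom_D:
  assumes k: "2 \<le> k"
  shows "group_hom (alternating_chains n k (D_complex K L f k))
    (alternating_chains n (k - 1) (D_complex K L f (k - 1))) (push (forget k))"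
proof -
  obtain m where m: "k = Suc m" "1 \<le> m" using k by (cases k) auto
  show ?thesis
    using keys_push_forget[of _ n k k] m
    by (intro group_hom.intro group_hom_axioms.intro group_alternating_chains homI)
      (simp_all add: carrier_alternating_D_chains push_eq frag_map_add
        antisymmetric_forget[unfolded push_eq])
qed

lemma push_forget_forget:
  assumes "antisymmetric (k + 1) c" "1 \<le> k"
  shows "push (forget k) (push (forget (k + 1)) c) = 0"
  using assms forget_forget_antisymmetric[of "k - 1" c] by simp

lemma exact_D:
  assumes k: "3 \<le> k"
  shows "exact_at
    (alternating_chains n (k + 1) (D_complex K L f (k + 1))) (push (forget (k + 1)))
    (alternating_chains n k (D_complex K L f k)) (push (forget k))
    (alternating_chains n (k - 1) (D_complex K L f (k - 1)))"
proof (rule exact_atI)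
  show "group_hom (alternating_chains n (k + 1) (D_complex K L f (k + 1)))
      (alternating_chains n k (D_complex K L f k)) (push (forget (k + 1)))"
    using group_hom_D[of "k + 1"] k by simp
  show "group_hom (alternating_chains n k (D_complex K L f k))
      (alternating_chains n (k - 1) (D_complex K L f (k - 1))) (push (forget k))"
    using group_hom_D k by simp
qed (use k alternating_exact[of _ n k] in
    \<open>auto simp: carrier_alternating_D_chains push_forget_forget[simplified] Bex_def\<close>)

lemma group_hom_D_2:
  "group_hom (alternating_chains n 2 (D_complex K L f 2)) (simplicial_chains n K)
    (push untuple \<circ> push (forget 2))"
  using keys_push_untuple keys_push_forget[of _ n 2 2]
  by (intro group_hom.intro group_hom_axioms.intro group_simplicial_chains group_alternating_chains homI)
    (simp_all add: carrier_alternating_D_chains carrier_simplicial_chains[of _ n K] push_eq frag_map_add)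

lemma exact_D_2:
  "exact_at
    (alternating_chains n 3 (D_complex K L f 3)) (push (forget 3))
    (alternating_chains n 2 (D_complex K L f 2)) (push untuple \<circ> push (forget 2))
    (simplicial_chains n K)"
proof (rule exact_atI[OF _ group_hom_D_2])
  show "group_hom (alternating_chains n 3 (D_complex K L f 3)) (alternating_chains n 2 (D_complex K L f 2))
      (push (forget 3))"
    using group_hom_D[of 3] by simp
  show "(push untuple \<circ> push (forget 2)) (push (forget 3) c) = \<one>\<^bsub>simplicial_chains n K\<^esub>"
    if "c \<in> carrier (alternating_chains n 3 (D_complex K L f 3))" for c
    using that push_forget_forget[of 2 c] by (simp add: carrier_alternating_D_chains push_eq)
  fix z assume z: "z \<in> carrier (alternating_chains n 2 (D_complex K L f 2))"
    "(push untuple \<circ> push (forget 2)) z = \<one>\<^bsub>simplicial_chains n K\<^esub>"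
  then have keys: "Poly_Mapping.keys z \<subseteq> fibre_power n 2" and a: "antisymmetric 2 z"
    by (simp_all add: carrier_alternating_D_chains)
  have "push (forget 2) z = 0"
    using push_untuple_eq_0[of "push (forget 2) z" n] keys_push_forget[OF keys, of 2] z(2) by simp
  then show "\<exists>w\<in>carrier (alternating_chains n 3 (D_complex K L f 3)). push (forget 3) w = z"
    using alternating_exact[OF keys a order_refl] by (auto simp: carrier_alternating_D_chains Bex_def)
qed

lemma exact_D_1:
  "exact_at
    (alternating_chains n 2 (D_complex K L f 2)) (push untuple \<circ> push (forget 2))
    (simplicial_chains n K) (push f)
    (simplicial_chains n L)"
proof (rule exact_atI[OF group_hom_D_2 group_hom_push_f])
  fix c assume "c \<in> carrier (alternating_chains n 2 (D_complex K L f 2))"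
  then have c: "Poly_Mapping.keys c \<subseteq> fibre_power n 2" and a: "antisymmetric 2 c"
    by (simp_all add: carrier_alternating_D_chains)
  let ?p = "\<lambda>c. push f (push untuple (push (forget 2) c))"
  have "permute (swap 1 2) x 2 = x 1" for x :: "nat \<Rightarrow> 'a"
  proof -
    have "inv_into UNIV (swap 1 2) = swap 1 2"
      by (rule inv_unique_comp) simp_all
    then show ?thesis by (simp add: permute_def)
  qed
  \<comment> \<open>Exchanging the components exchanges the two projections to X. Antisymmetry
    relates these by a sign whereas \<open>f\<close> identifies them, so the common image is its own
    negative.\<close>
  then have "untuple \<circ> forget 1 \<circ> permute (swap 1 2) = (untuple \<circ> forget 2 :: (nat \<Rightarrow> 'a) \<Rightarrow> _)"
    by (simp add: fun_eq_iff untuple_def forget_def numeral_2_eq_2)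
  then have "push untuple (push (forget 2) c) = push untuple (push (forget 1) (push (permute (swap 1 2)) c))"
    by (simp add: push_eq frag_map_frag_map comp_assoc)
  also have "push (permute (swap 1 2)) c = - c"
    using antisymmetric_transpose[OF a, of 1 2] by simp
  finally have "?p c = - push f (push untuple (push (forget 1) c))"
    by (simp add: push_eq frag_map_uminus)
  also have "\<dots> = - ?p c"
    using push_f_forget[OF c, of 1] push_f_forget[OF c, of 2] by simp
  finally show "push f ((push untuple \<circ> push (forget 2)) c) = \<one>\<^bsub>simplicial_chains n L\<^esub>"
    using frag_eq_minus_self by simp
qed (use alternating_exact_base[of _ n] in
    \<open>auto simp: carrier_alternating_D_chains carrier_simplicial_chains[of _ n K] Bex_def\<close>)

end

theorem theorem2p4:
  fixes K :: "'a::euclidean_space set set"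
    and L :: "'b::euclidean_space set set"
    and f :: "'a \<Rightarrow> 'b"
  assumes "locally_finite_complex K"
    and "locally_finite_complex L"
    and "simplicial_map K L f"
    and "f ` (\<Union>K) = \<Union>L"
    and "\<forall>y\<in>\<Union>L. finite {x \<in> \<Union>K. f x = y}"
  shows
    "(\<forall>k\<ge>2. \<forall>i\<in>{1..k}.
        forget i ` W_space f (\<Union>K) k \<subseteq> W_space f (\<Union>K) (k - 1) \<and>
        simplicial_map (W_complex K L f k) (W_complex K L f (k - 1)) (forget i) \<and>
        forget i ` D_space f (\<Union>K) k \<subseteq> D_space f (\<Union>K) (k - 1) \<and>
        simplicial_map (D_complex K L f k) (D_complex K L f (k - 1)) (forget i)) \<and>
     (\<forall>i\<in>{1..2}.
        simplicial_map (W_complex K L f 2) K (untuple \<circ> forget i) \<and>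
        simplicial_map (D_complex K L f 2) K (untuple \<circ> forget i)) \<and>
     (\<forall>n.
        (\<forall>k\<ge>3. exact_at
           (simplicial_chains n (W_complex K L f (k + 1))) (rho (k + 1))
           (simplicial_chains n (W_complex K L f k)) (rho k)
           (simplicial_chains n (W_complex K L f (k - 1)))) \<and>
        exact_at
           (simplicial_chains n (W_complex K L f 3)) (rho 3)
           (simplicial_chains n (W_complex K L f 2)) (push untuple \<circ> rho 2)
           (simplicial_chains n K) \<and>
        exact_at
           (simplicial_chains n (W_complex K L f 2)) (push untuple \<circ> rho 2)
           (simplicial_chains n K) (push f)
           (simplicial_chains n L) \<and>
        push f \<in> epi (simplicial_chains n K) (simplicial_chains n L)) \<and>
     (\<forall>n.
        (\<forall>k\<ge>3. exact_at
           (alternating_chains n (k + 1) (D_complex K L f (k + 1))) (push (forget (k + 1)))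
           (alternating_chains n k (D_complex K L f k)) (push (forget k))
           (alternating_chains n (k - 1) (D_complex K L f (k - 1)))) \<and>
        exact_at
           (alternating_chains n 3 (D_complex K L f 3)) (push (forget 3))
           (alternating_chains n 2 (D_complex K L f 2)) (push untuple \<circ> push (forget 2))
           (simplicial_chains n K) \<and>
        exact_at
           (alternating_chains n 2 (D_complex K L f 2)) (push untuple \<circ> push (forget 2))
           (simplicial_chains n K) (push f)
           (simplicial_chains n L) \<and>
        push f \<in> epi (simplicial_chains n K) (simplicial_chains n L))"
proof -
  interpret finite_to_one_simplicial_map K L f
    using assms by unfold_locales
  have W: "simplicial_map (W_complex K L f k) (W_complex K L f (k - 1)) (forget i)"
    and W_space: "forget i ` W_space f (\<Union>K) k \<subseteq> W_space f (\<Union>K) (k - 1)"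
    and D: "simplicial_map (D_complex K L f k) (D_complex K L f (k - 1)) (forget i)"
    if "2 \<le> k" "i \<in> {1..k}" for k i
  proof -
    show W: "forget i ` W_space f (\<Union>K) k \<subseteq> W_space f (\<Union>K) (k - 1)"
      using forget_W_space[OF _ that(2)] by blast
    show "simplicial_map (W_complex K L f k) (W_complex K L f (k - 1)) (forget i)"
      unfolding W_complex_def by (rule simplicial_forget[OF order_refl W that])
    show "simplicial_map (D_complex K L f k) (D_complex K L f (k - 1)) (forget i)"
      unfolding D_complex_def by (rule simplicial_forget[OF D_space_subset forget_D_space that]) (rule that(2))
  qed
  have untuple: "simplicial_map (W_complex K L f 2) K (untuple \<circ> forget i)"
    "simplicial_map (D_complex K L f 2) K (untuple \<circ> forget i)" if "i \<in> {1..2}" for i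
    unfolding W_complex_def D_complex_def
    using simplicial_untuple_forget[OF _ that] D_space_subset by blast+
  show ?thesis
    by (intro conjI allI ballI impI;
      rule W W_space D forget_D_space untuple exact_W exact_W_2 exact_W_1 exact_D exact_D_2 exact_D_1
        push_f_epi; assumption)
qed

end
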